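(* Let $G$ be a torsion-free abelian group. Then $G$ is semi-generalized Bassian if, and only if, one of the following holds: (1) $G$ has finite rank; (2) $G \cong D \oplus R$, where $D$ is divisible (of infinite rank) and $R$ is a finite rank completely (fully) decomposable homogeneous group.
   Context: All groups are additively written abelian groups. A subgroup $H$ of a group $A$ is essential in $A$ if $H \cap S \neq \{0\}$ for every non-zero subgroup $S$ of $A$. A group $G$ is semi-generalized Bassian if, for every subgroup $H \le G$, the existence of an injective homomorphism $G \to G/H$ implies that $H$ is an essential subgroup of some direct summand of $G$. A torsion-free group is fully decomposable if it is a direct sum of rank-one groups, and homogeneous if all its non-zero elements have the same type. *)

theory Defs
  imports "HOL-Algebra.Algebra" "HOL-Library.Extended_Nat" "HOL-Computational_Algebra.Primes"
begin

text \<open>Abelian groups are modelled as HOL-Algebra commutative groups (written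
multiplicatively: the group operation plays the role of +, the unit that of 0).\<close>

definition torsion_free :: "('a, 'b) monoid_scheme \<Rightarrow> bool" where
  "torsion_free G \<longleftrightarrow>
     (\<forall>x\<in>carrier G. \<forall>n::nat. n > 0 \<longrightarrow> x [^]\<^bsub>G\<^esub> n = \<one>\<^bsub>G\<^esub> \<longrightarrow> x = \<one>\<^bsub>G\<^esub>)"

definition divisible :: "('a, 'b) monoid_scheme \<Rightarrow> bool" where
  "divisible G \<longleftrightarrow>
     (\<forall>x\<in>carrier G. \<forall>n::nat. n > 0 \<longrightarrow> (\<exists>y\<in>carrier G. y [^]\<^bsub>G\<^esub> n = x))"

definition independent :: "('a, 'b) monoid_scheme \<Rightarrow> 'a set \<Rightarrow> bool" where
  "independent G S \<longleftrightarrow> S \<subseteq> carrier G \<and>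
     (\<forall>F (c :: 'a \<Rightarrow> int). finite F \<longrightarrow> F \<subseteq> S \<longrightarrow>
        finprod G (\<lambda>s. s [^]\<^bsub>G\<^esub> c s) F = \<one>\<^bsub>G\<^esub> \<longrightarrow> (\<forall>s\<in>F. c s = 0))"

definition maximal_independent :: "('a, 'b) monoid_scheme \<Rightarrow> 'a set \<Rightarrow> bool" where
  "maximal_independent G S \<longleftrightarrow> independent G S \<and>
     (\<forall>T. independent G T \<longrightarrow> S \<subseteq> T \<longrightarrow> T = S)"

definition finite_rank :: "('a, 'b) monoid_scheme \<Rightarrow> bool" where
  "finite_rank G \<longleftrightarrow> (\<exists>S. maximal_independent G S \<and> finite S)"

definition rank_one :: "('a, 'b) monoid_scheme \<Rightarrow> bool" where
  "rank_one G \<longleftrightarrow> (\<exists>S. maximal_independent G S \<and> card S = 1)"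

definition height :: "('a, 'b) monoid_scheme \<Rightarrow> nat \<Rightarrow> 'a \<Rightarrow> enat" where
  "height G p x = Sup {enat k | k. \<exists>y\<in>carrier G. y [^]\<^bsub>G\<^esub> (p ^ k) = x}"

definition same_type :: "('a, 'b) monoid_scheme \<Rightarrow> 'a \<Rightarrow> 'a \<Rightarrow> bool" where
  "same_type G x y \<longleftrightarrow>
     finite {p::nat. Factorial_Ring.prime p \<and> height G p x \<noteq> height G p y} \<and>
     (\<forall>p::nat. Factorial_Ring.prime p \<longrightarrow> height G p x \<noteq> height G p y \<longrightarrow>
          height G p x \<noteq> \<infinity> \<and> height G p y \<noteq> \<infinity>)"

definition homogeneous :: "('a, 'b) monoid_scheme \<Rightarrow> bool" where
  "homogeneous G \<longleftrightarrow>
     (\<forall>x\<in>carrier G. \<forall>y\<in>carrier G. x \<noteq> \<one>\<^bsub>G\<^esub> \<longrightarrow> y \<noteq> \<one>\<^bsub>G\<^esub> \<longrightarrow> same_type G x y)"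

definition fully_decomposable :: "('a, 'b) monoid_scheme \<Rightarrow> bool" where
  "fully_decomposable G \<longleftrightarrow>
     (\<exists>\<A> :: 'a set set.
        (\<forall>A\<in>\<A>. subgroup A G \<and> rank_one (G\<lparr>carrier := A\<rparr>)) \<and>
        generate G (\<Union>\<A>) = carrier G \<and>
        (\<forall>F (a :: 'a set \<Rightarrow> 'a). finite F \<longrightarrow> F \<subseteq> \<A> \<longrightarrow> (\<forall>A\<in>F. a A \<in> A) \<longrightarrow>
            finprod G a F = \<one>\<^bsub>G\<^esub> \<longrightarrow> (\<forall>A\<in>F. a A = \<one>\<^bsub>G\<^esub>)))"

definition direct_summand :: "('a, 'b) monoid_scheme \<Rightarrow> 'a set \<Rightarrow> bool" where
  "direct_summand G A \<longleftrightarrow> subgroup A G \<and>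
     (\<exists>B. subgroup B G \<and> A \<inter> B = {\<one>\<^bsub>G\<^esub>} \<and> A <#>\<^bsub>G\<^esub> B = carrier G)"

definition essential_in :: "('a, 'b) monoid_scheme \<Rightarrow> 'a set \<Rightarrow> 'a set \<Rightarrow> bool" where
  "essential_in G H A \<longleftrightarrow> H \<subseteq> A \<and>
     (\<forall>S. subgroup S G \<longrightarrow> S \<subseteq> A \<longrightarrow> S \<noteq> {\<one>\<^bsub>G\<^esub>} \<longrightarrow> H \<inter> S \<noteq> {\<one>\<^bsub>G\<^esub>})"

definition semi_generalized_Bassian :: "('a, 'b) monoid_scheme \<Rightarrow> bool" where
  "semi_generalized_Bassian G \<longleftrightarrow>
     (\<forall>H. subgroup H G \<longrightarrow>
        (\<exists>f. f \<in> hom G (G Mod H) \<and> inj_on f (carrier G)) \<longrightarrow>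
        (\<exists>A. direct_summand G A \<and> essential_in G H A))"

end

theory Submission
  imports Defs "HOL-Library.Function_Algebras"
begin

text \<open>
  The coordinates with respect to a maximal independent set embed a torsion-free group \<open>G\<close> as an
  additive subgroup \<open>M\<close> of a rational vector space. There the pure hull of \<open>H\<close> is \<open>M \<inter> span H\<close>,
  divisible subgroups are subspaces, and \<open>G\<close> is semi-generalized Bassian iff \<open>M \<inter> span H\<close> is a
  summand of \<open>M\<close> whenever \<open>M\<close> embeds in \<open>M / H\<close>.

  In finite rank such an embedding forces \<open>H = 0\<close>. If \<open>M = D \<oplus> R\<close> with \<open>D\<close> a subspace and
  \<open>R = T x\<^sub>1 + \<dots> + T x\<^sub>n\<close> for a group \<open>T\<close> of rationals, all pure subgroups are summands: a Euclidean
  algorithm on the generators of \<open>R\<close> makes them independent modulo the given pure subgroup.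

  Conversely, let \<open>M\<close> have infinite rank, \<open>D\<close> its largest subspace and \<open>M = D \<oplus> R\<close>. If \<open>R\<close> had
  infinite rank, it would embed in a quotient \<open>R / K\<close> that contains a divisible group, and splitting off
  the pure hull of \<open>K\<close> would contradict the maximality of \<open>D\<close>. So \<open>R\<close> has finite rank, \<open>M\<close> embeds in
  \<open>D\<close>, and therefore all pure subgroups of \<open>R\<close> are summands. This splits \<open>R\<close> into rank-one groups,
  and applied to the pure hulls of the elements \<open>p x + y\<close> it shows that their types agree.
\<close>

section \<open>Additive subgroups of rational vector spaces\<close>

text \<open>A direct summand is pure, and if \<open>H\<close> is essential in it, each of its
  elements has a non-zero multiple in \<open>H\<close>; this forces the summand to be
  \<open>M \<inter> span H\<close>. In finite rank, an embedding of \<open>M\<close> in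
  \<open>M / H\<close> extends to an injective linear map from \<open>span M\<close> to
  \<open>span M / span H\<close>, so the dimension leaves only \<open>H = 0\<close>. The Euclidean
  algorithm applies to \<open>T x\<^sub>1 + ... + T x\<^sub>n\<close> because all generators carry
  the same \<open>T\<close>: integer changes of generators preserve this shape although
  \<open>T\<close> is merely a group. Equality of types does not yet give a common \<open>T\<close>,
  as heights may differ at finitely many primes; the generators are rescaled until their
  characteristics agree exactly. In the converse direction, the embedding of \<open>M\<close> in
  \<open>D\<close> stays injective modulo every subgroup of \<open>R\<close>, since \<open>D\<close>
  and \<open>R\<close> meet in 0. There the type of \<open>y\<close> being at most that of
  \<open>z\<close> is expressed by one positive integer \<open>k\<close>: whenever
  \<open>y / m\<close> lies in \<open>R\<close>, so does \<open>k z / m\<close>. All denominators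
  \<open>m\<close> are thus treated at once, and heights at primes appear only in the transfer to
  the given definitions.\<close>

definition add_subgroup :: "'b::ab_group_add set \<Rightarrow> bool" where
  "add_subgroup H \<longleftrightarrow> 0 \<in> H \<and> (\<forall>x\<in>H. \<forall>y\<in>H. x - y \<in> H)"

lemma add_subgroup_zero: "add_subgroup H \<Longrightarrow> 0 \<in> H"
  and add_subgroup_diff: "add_subgroup H \<Longrightarrow> x \<in> H \<Longrightarrow> y \<in> H \<Longrightarrow> x - y \<in> H"
  by (auto simp: add_subgroup_def)

lemma add_subgroup_uminus: "add_subgroup H \<Longrightarrow> x \<in> H \<Longrightarrow> - x \<in> H"
  using add_subgroup_diff[of H 0 x] by (simp add: add_subgroup_zero)

lemma add_subgroup_add: "add_subgroup H \<Longrightarrow> x \<in> H \<Longrightarrow> y \<in> H \<Longrightarrow> x + y \<in> H"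
  using add_subgroup_diff[of H x "- y"] by (simp add: add_subgroup_uminus)

lemma add_subgroup_sum: "add_subgroup H \<Longrightarrow> (\<And>i. i \<in> I \<Longrightarrow> f i \<in> H) \<Longrightarrow> sum f I \<in> H"
  by (induction I rule: infinite_finite_induct) (auto simp: add_subgroup_zero add_subgroup_add)

lemma add_subgroup_Int: "add_subgroup H \<Longrightarrow> add_subgroup K \<Longrightarrow> add_subgroup (H \<inter> K)"
  by (auto simp: add_subgroup_def)

section \<open>Internal direct sums of additive subgroups\<close>

definition direct_sum :: "'b::ab_group_add set \<Rightarrow> 'b set \<Rightarrow> 'b set \<Rightarrow> bool" where
  "direct_sum M A C \<longleftrightarrow> add_subgroup A \<and> add_subgroup C \<and> A \<inter> C = {0} \<and>
     M = {a + c | a c. a \<in> A \<and> c \<in> C}"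

lemma direct_sum_eq: "direct_sum M A C \<Longrightarrow> M = {a + c | a c. a \<in> A \<and> c \<in> C}"
  and direct_sum_subgroups: "direct_sum M A C \<Longrightarrow> add_subgroup A" "direct_sum M A C \<Longrightarrow> add_subgroup C"
  and direct_sum_disjoint: "direct_sum M A C \<Longrightarrow> x \<in> A \<Longrightarrow> x \<in> C \<Longrightarrow> x = 0"
  by (auto simp: direct_sum_def)

lemma direct_sum_left:
  assumes "direct_sum M A C" "x \<in> A" shows "x \<in> M"
  unfolding direct_sum_eq[OF assms(1)]
  using assms(2) add_subgroup_zero[OF direct_sum_subgroups(2)[OF assms(1)]] by force

lemma direct_sum_right:
  assumes "direct_sum M A C" "x \<in> C" shows "x \<in> M"
  unfolding direct_sum_eq[OF assms(1)]
  using assms(2) add_subgroup_zero[OF direct_sum_subgroups(1)[OF assms(1)]] by force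

lemma direct_sum_decomp:
  assumes "direct_sum M A C" "x \<in> M"
  obtains a c where "a \<in> A" "c \<in> C" "x = a + c"
  using assms(2) that unfolding direct_sum_eq[OF assms(1)] by blast

lemma direct_sum_unique:
  assumes "direct_sum M A C" "a \<in> A" "a' \<in> A" "c \<in> C" "c' \<in> C" "a + c = a' + c'"
  shows "a = a'" "c = c'"
proof -
  have "a - a' = c' - c"
    using assms(6) by (simp add: algebra_simps)
  then have "a - a' \<in> C" using assms(4,5) add_subgroup_diff[OF direct_sum_subgroups(2)[OF assms(1)]] by simp
  moreover have "a - a' \<in> A" using assms(2,3) add_subgroup_diff[OF direct_sum_subgroups(1)[OF assms(1)]] by simp
  ultimately have "a - a' = 0" by (intro direct_sum_disjoint[OF assms(1)])
  then show "a = a'" "c = c'" using assms(6) by auto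
qed

lemma direct_sum_add_subgroup:
  assumes "direct_sum M A C" shows "add_subgroup M"
proof -
  have AC: "add_subgroup A" "add_subgroup C" and M: "M = {a + c | a c. a \<in> A \<and> c \<in> C}"
    using assms by (auto simp: direct_sum_def)
  have "x - y \<in> M" if xy: "x \<in> M" "y \<in> M" for x y
  proof -
    obtain a c a' c' where *: "a \<in> A" "c \<in> C" "x = a + c" "a' \<in> A" "c' \<in> C" "y = a' + c'"
      using xy M by blast
    then have "x - y = (a - a') + (c - c')" by simp
    then show ?thesis unfolding M using * AC add_subgroup_diff by blast
  qed
  moreover have "0 \<in> M" using direct_sum_left[OF assms add_subgroup_zero[OF AC(1)]] .
  ultimately show ?thesis by (simp add: add_subgroup_def)
qed

text \<open>Dedekind's modular law: as \<open>A\<close> lies in \<open>R\<close>, the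
  \<open>C\<close>-component \<open>r - a\<close> of an element \<open>r\<close> of \<open>R\<close>
  stays in \<open>R\<close>. It cuts splittings of \<open>M\<close> down to splittings of a
  subgroup.\<close>

lemma direct_sum_modular:
  assumes M: "direct_sum M A C" and R: "add_subgroup R" "A \<subseteq> R" "R \<subseteq> M"
  shows "direct_sum R A (C \<inter> R)"
proof -
  have "\<exists>a c. r = a + c \<and> a \<in> A \<and> c \<in> C \<inter> R" if r: "r \<in> R" for r
  proof -
    obtain a c where ac: "a \<in> A" "c \<in> C" "r = a + c" using direct_sum_decomp[OF M] r R(3) by blast
    then have "c = r - a" by simp
    then have "c \<in> R" using add_subgroup_diff[OF R(1) r subsetD[OF R(2) ac(1)]] by simp
    then show ?thesis using ac by blast
  qed
  moreover have "0 \<in> A \<inter> (C \<inter> R)"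
    using add_subgroup_zero direct_sum_subgroups[OF M] R(1) by blast
  moreover have "a + c \<in> R" if "a \<in> A" "c \<in> C \<inter> R" for a c
    using that R add_subgroup_add by blast
  ultimately show ?thesis unfolding direct_sum_def
    using direct_sum_subgroups[OF M] R(1) direct_sum_disjoint[OF M] add_subgroup_Int by auto
qed

lemma common_denominator:
  fixes t :: "'i \<Rightarrow> rat"
  assumes "finite I"
  obtains N :: nat and c :: "'i \<Rightarrow> int" where "N > 0" "\<And>i. i \<in> I \<Longrightarrow> of_nat N * t i = of_int (c i)"
proof -
  have "\<exists>N::nat. N > 0 \<and> (\<forall>i\<in>I. of_nat N * t i \<in> \<int>)"
    using assms
  proof induction
    case empty
    then show ?case by auto
  next
    case (insert i I)
    then obtain N :: nat where N: "N > 0" "\<forall>i\<in>I. of_nat N * t i \<in> \<int>" by auto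
    obtain a b where ab: "quotient_of (t i) = (a, b)" by (cases "quotient_of (t i)")
    then have b: "b > 0" and t: "t i = of_int a / of_int b"
      by (simp_all add: quotient_of_denom_pos quotient_of_div)
    have nb: "of_nat (nat b) = (of_int b :: rat)" using b by simp
    have "of_nat (N * nat b) * t j \<in> \<int>" if "j \<in> insert i I" for j
    proof (cases "j = i")
      case True
      have "of_nat (N * nat b) * t j = of_int (int N * a)"
        using b t True by (simp add: nb)
      then show ?thesis by (metis Ints_of_int)
    next
      case False
      have "of_nat (N * nat b) * t j = of_int b * (of_nat N * t j)"
        by (simp add: nb)
      then show ?thesis using False that N by (metis Ints_mult Ints_of_int insertE)
    qed
    then show ?case using N b by (intro exI[of _ "N * nat b"]) auto
  qed
  then obtain N :: nat where "N > 0" and N: "\<forall>i\<in>I. of_nat N * t i \<in> \<int>" by blast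
  then have "\<forall>i\<in>I. \<exists>c. of_nat N * t i = of_int c" by (auto elim!: Ints_cases)
  then show ?thesis using that[OF \<open>N > 0\<close>] by metis
qed

section \<open>Multiples, spans and projections in rational vector spaces\<close>

locale rat_vector_space = vector_space scale
  for scale :: "rat \<Rightarrow> 'b::ab_group_add \<Rightarrow> 'b" (infixr \<open>*s\<close> 75)
begin

sublocale endo: vector_space_pair scale scale ..

lemma subspace_add_subgroup: "subspace S \<Longrightarrow> add_subgroup S"
  by (simp add: add_subgroup_def subspace_0 subspace_diff)

lemma add_subgroup_scale_nat:
  assumes "add_subgroup H" "x \<in> H" shows "of_nat n *s x \<in> H"
  by (induction n) (auto simp: assms add_subgroup_zero add_subgroup_add scale_left_distrib)

lemma add_subgroup_scale_int:
  assumes "add_subgroup H" "x \<in> H" shows "of_int k *s x \<in> H"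
proof (cases k)
  case (nonneg n)
  then show ?thesis using add_subgroup_scale_nat[OF assms, of n] by simp
next
  case (neg n)
  then show ?thesis
    using add_subgroup_uminus[OF assms(1) add_subgroup_scale_nat[OF assms, of "Suc n"]]
    by (simp add: algebra_simps del: of_nat_Suc)
qed

lemma in_subspace_scale_iff: "subspace W \<Longrightarrow> q \<noteq> 0 \<Longrightarrow> q *s x \<in> W \<longleftrightarrow> x \<in> W"
  using subspace_scale[of W "q *s x" "inverse q"] by (auto simp: subspace_scale)

text \<open>Denominators of a rational combination can be cleared. Hence \<open>span H\<close> is
  the divisible hull of \<open>H\<close>, and \<open>M \<inter> span H\<close> its pure hull in
  \<open>M\<close>.\<close>

lemma span_add_subgroup_multiple:
  assumes H: "add_subgroup H" and x: "x \<in> span H"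
  obtains n :: nat where "n > 0" "of_nat n *s x \<in> H"
proof -
  have "\<exists>n::nat. n > 0 \<and> of_nat n *s x \<in> H"
    using x
  proof (induction rule: span_induct_alt)
    case base
    then show ?case using H by (auto simp: add_subgroup_zero)
  next
    case (step c x y)
    then obtain n :: nat where n: "n > 0" "of_nat n *s y \<in> H" by blast
    obtain N :: nat and k where N: "N > 0" "of_nat N * c = of_int (k ())"
      using common_denominator[of "{()}" "\<lambda>_. c"] by auto
    have "of_nat (n * N) *s (c *s x + y) = of_int (int n * k ()) *s x + of_nat N *s of_nat n *s y"
      using N(2) by (simp add: scale_right_distrib mult.assoc mult.commute)
    also have "\<dots> \<in> H"
      using step n add_subgroup_scale_nat[OF H n(2)] by (intro add_subgroup_add add_subgroup_scale_int H)
    finally show ?case using n N by (intro exI[of _ "n * N"]) auto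
  qed
  then show ?thesis using that by blast
qed

lemma subspace_projection:
  assumes "subspace E"
  obtains p where "Vector_Spaces.linear scale scale p" "\<And>x. p x \<in> E" "\<And>x. x \<in> E \<Longrightarrow> p x = x"
  using endo.linear_exists_left_inverse_on[OF linear_id assms inj_on_id] by (auto simp: image_subset_iff)

section \<open>Splitting pure subgroups by Euclidean reduction of generators\<close>

lemma add_subgroup_combinations:
  assumes T: "add_subgroup T"
  shows "add_subgroup {\<Sum>i\<in>I. t i *s x i | t. \<forall>i\<in>I. t i \<in> T}" (is "add_subgroup ?C")
proof -
  have "0 \<in> ?C" using add_subgroup_zero[OF T] by (auto intro!: exI[of _ "\<lambda>_. 0"])
  moreover have "u - v \<in> ?C" if uv: "u \<in> ?C" "v \<in> ?C" for u v
  proof -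
    obtain t t' where "\<forall>i\<in>I. t i \<in> T" "u = (\<Sum>i\<in>I. t i *s x i)"
      "\<forall>i\<in>I. t' i \<in> T" "v = (\<Sum>i\<in>I. t' i *s x i)" using uv by blast
    then show ?thesis
      by (auto simp: sum_subtractf[symmetric] scale_left_diff_distrib[symmetric]
          intro!: exI[of _ "\<lambda>i. t i - t' i"] add_subgroup_diff[OF T])
  qed
  ultimately show ?thesis by (simp add: add_subgroup_def)
qed

text \<open>Given an integer relation modulo \<open>W\<close> between the generators, a Euclidean step
  replaces \<open>x j\<close> by \<open>x j \<plusminus> x i\<close> and \<open>c i\<close> by \<open>c i \<mp> c j\<close>, which decreases \<open>\<Sum>i. \<bar>c i\<bar>\<close>.\<close>
lemma generator_in_subspace:
  fixes c :: "'i \<Rightarrow> int"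
  assumes T: "add_subgroup T" and R: "add_subgroup R" and W: "subspace W" and I: "finite I"
    and "(\<Sum>i\<in>I. of_int (c i) *s x i) \<in> W" "\<exists>i\<in>I. c i \<noteq> 0"
    and "\<And>i t. i \<in> I \<Longrightarrow> t \<in> T \<Longrightarrow> t *s x i \<in> R"
    and "\<And>r. r \<in> R \<Longrightarrow> \<exists>t. (\<forall>i\<in>I. t i \<in> T) \<and> r - (\<Sum>i\<in>I. t i *s x i) \<in> W"
  shows "\<exists>x'. (\<exists>i\<in>I. x' i \<in> W) \<and> (\<forall>i\<in>I. \<forall>t\<in>T. t *s x' i \<in> R) \<and>
    (\<forall>r\<in>R. \<exists>t. (\<forall>i\<in>I. t i \<in> T) \<and> r - (\<Sum>i\<in>I. t i *s x' i) \<in> W)"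
  using assms(5-)
proof (induction "\<Sum>i\<in>I. nat \<bar>c i\<bar>" arbitrary: c x rule: less_induct)
  case less
  note rel = less.prems(1) and mem = less.prems(3) and gen = less.prems(4)
  \<comment> \<open>\<open>j = i\<close> encodes the terminal case of a single non-zero coefficient;
    otherwise \<open>i\<close> carries the larger absolute value, so the step shrinks
    \<open>c i\<close>.\<close>
  obtain i j where ij: "i \<in> I" "j \<in> I" "c i \<noteq> 0" "j \<noteq> i \<longrightarrow> c j \<noteq> 0 \<and> \<bar>c j\<bar> \<le> \<bar>c i\<bar>"
    "j = i \<longrightarrow> (\<forall>k\<in>I. k \<noteq> i \<longrightarrow> c k = 0)"
  proof -
    obtain i where i: "i \<in> I" "c i \<noteq> 0" using less.prems by blast
    show ?thesis
    proof (cases "\<exists>j\<in>I. j \<noteq> i \<and> c j \<noteq> 0")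
      case True
      then obtain j where "j \<in> I" "j \<noteq> i" "c j \<noteq> 0" by blast
      then show ?thesis using i that[of i j] that[of j i] by (cases "\<bar>c j\<bar> \<le> \<bar>c i\<bar>") auto
    next
      case False
      then show ?thesis using that[of i i] i by auto
    qed
  qed
  show ?case
  proof (cases "j = i")
    case True
    have "(\<Sum>k\<in>I. of_int (c k) *s x k) = of_int (c i) *s x i"
      using ij True I by (subst sum.remove[of _ i]) auto
    then have "x i \<in> W" using rel ij(3) by (simp add: in_subspace_scale_iff[OF W])
    then show ?thesis using ij mem gen by (intro exI[of _ x]) auto
  next
    case False
    \<comment> \<open>The sign is chosen so that \<open>s * c j\<close> has the sign of
      \<open>c i\<close>, which makes the absolute value drop by exactly
      \<open>\<bar>c j\<bar>\<close>.\<close>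
    define s where "s = sgn (c i) * sgn (c j)"
    define c' where "c' = c(i := c i - s * c j)"
    define x' where "x' = x(j := x j + of_int s *s x i)"
    have split: "sum f I = f i + f j + sum f (I - {i, j})" for f :: "'i \<Rightarrow> 'c::ab_group_add"
    proof -
      have "sum f I = sum f (insert i (insert j (I - {i, j})))"
        using ij by (intro sum.cong) auto
      then show ?thesis using False I by (simp add: add.assoc)
    qed
    \<comment> \<open>The change of generators is an elementary integer matrix, so it acts on
      coefficient vectors by additions and subtractions only, and these stay in
      \<open>T\<close>.\<close>
    have comb: "(\<Sum>k\<in>I. t k *s x k) = (\<Sum>k\<in>I. (t(i := t i - of_int s * t j)) k *s x' k)" for t
    proof -
      have "(\<Sum>k\<in>I - {i, j}. t k *s x k) = (\<Sum>k\<in>I - {i, j}. (t(i := t i - of_int s * t j)) k *s x' k)"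
        by (intro sum.cong) (auto simp: x'_def)
      then show ?thesis using False
        by (simp add: split x'_def scale_left_diff_distrib scale_right_distrib mult.commute)
    qed
    have "\<bar>c i - s * c j\<bar> = \<bar>c i\<bar> - \<bar>c j\<bar>"
      using ij False unfolding s_def by (auto simp: sgn_if abs_if split: if_splits)
    then have "\<bar>c' i\<bar> < \<bar>c i\<bar>" using ij False by (simp add: c'_def)
    then have dec: "(\<Sum>k\<in>I. nat \<bar>c' k\<bar>) < (\<Sum>k\<in>I. nat \<bar>c k\<bar>)"
      using ij I by (intro sum_strict_mono_ex1) (auto simp: c'_def)
    have of_c': "(\<lambda>k. of_int (c' k)) = (\<lambda>k. of_int (c k) :: rat)(i := of_int (c i) - of_int s * of_int (c j))"
      by (auto simp: c'_def)
    have "(\<Sum>k\<in>I. of_int (c' k) *s x' k) \<in> W"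
      using rel unfolding comb[of "\<lambda>k. of_int (c k)"] of_c'[symmetric] .
    moreover have "\<exists>k\<in>I. c' k \<noteq> 0" using ij False by (intro bexI[of _ j]) (auto simp: c'_def)
    moreover have "t *s x' k \<in> R" if "k \<in> I" "t \<in> T" for k t
      using mem[OF that] mem[OF ij(1) that(2)] add_subgroup_scale_int[OF R, of "t *s x i" s]
      by (auto simp: x'_def scale_right_distrib mult.commute intro!: add_subgroup_add[OF R])
    moreover have "\<exists>t. (\<forall>i\<in>I. t i \<in> T) \<and> r - (\<Sum>i\<in>I. t i *s x' i) \<in> W" if r: "r \<in> R" for r
    proof -
      obtain t where t: "\<forall>i\<in>I. t i \<in> T" "r - (\<Sum>i\<in>I. t i *s x i) \<in> W" using gen[OF r] by blast
      have "t i - of_int s * t j \<in> T"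
        using t ij add_subgroup_diff[OF T] add_subgroup_uminus[OF T]
        by (auto simp: s_def sgn_if)
      then show ?thesis using t ij unfolding comb[of t]
        by (intro exI[of _ "t(i := t i - of_int s * t j)"]) auto
    qed
    ultimately show ?thesis by (intro less.hyps[OF dec])
  qed
qed

lemma finite_type_module_pure_splits:
  assumes T: "add_subgroup T" and R: "add_subgroup R" and W: "subspace W"
    and "finite I"
    and "\<And>i t. i \<in> I \<Longrightarrow> t \<in> T \<Longrightarrow> t *s x i \<in> R"
    and "\<And>r. r \<in> R \<Longrightarrow> \<exists>t. (\<forall>i\<in>I. t i \<in> T) \<and> r - (\<Sum>i\<in>I. t i *s x i) \<in> W"
  shows "\<exists>C. direct_sum R (R \<inter> W) C"
  using assms(4-)
proof (induction "card I" arbitrary: I x rule: less_induct)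
  case less
  note I = less.prems(1) and mem = less.prems(2) and gen = less.prems(3)
  show ?case
  proof (cases "\<exists>c. (\<Sum>i\<in>I. of_int (c i) *s x i) \<in> W \<and> (\<exists>i\<in>I. c i \<noteq> 0)")
    case True
    then obtain c where "(\<Sum>i\<in>I. of_int (c i) *s x i) \<in> W" "\<exists>i\<in>I. c i \<noteq> 0" by blast
    from generator_in_subspace[OF T R W I this mem gen]
    obtain x' k where x': "k \<in> I" "x' k \<in> W" "\<forall>i\<in>I. \<forall>t\<in>T. t *s x' i \<in> R"
      and gen': "\<forall>r\<in>R. \<exists>t. (\<forall>i\<in>I. t i \<in> T) \<and> r - (\<Sum>i\<in>I. t i *s x' i) \<in> W" by blast
    show ?thesis
    proof (rule less.hyps)
      show "card (I - {k}) < card I" using I x' by (intro psubset_card_mono) auto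
      fix r assume "r \<in> R"
      then obtain t where t: "\<forall>i\<in>I. t i \<in> T" "r - (\<Sum>i\<in>I. t i *s x' i) \<in> W" using gen' by blast
      have "(\<Sum>i\<in>I. t i *s x' i) = t k *s x' k + (\<Sum>i\<in>I - {k}. t i *s x' i)"
        using I x' by (simp add: sum.remove)
      then have "r - (\<Sum>i\<in>I - {k}. t i *s x' i) = (r - (\<Sum>i\<in>I. t i *s x' i)) + t k *s x' k"
        by simp
      also have "\<dots> \<in> W" using t x' by (intro subspace_add[OF W] subspace_scale[OF W])
      finally show "\<exists>t. (\<forall>i\<in>I - {k}. t i \<in> T) \<and> r - (\<Sum>i\<in>I - {k}. t i *s x' i) \<in> W"
        using t by blast
    qed (use I x' in auto)
  next
    case False
    define C where "C = {\<Sum>i\<in>I. t i *s x i | t. \<forall>i\<in>I. t i \<in> T}"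
    have CR: "C \<subseteq> R" unfolding C_def using mem by (auto intro!: add_subgroup_sum[OF R])
    have C: "add_subgroup C" unfolding C_def by (rule add_subgroup_combinations[OF T])
    have "v = 0" if "v \<in> C" "v \<in> W" for v
    proof -
      obtain t where t: "v = (\<Sum>i\<in>I. t i *s x i)" using \<open>v \<in> C\<close> unfolding C_def by blast
      \<comment> \<open>Clearing denominators turns \<open>v \<in> W\<close> into an integer
        relation modulo \<open>W\<close>, and the case assumption admits only the trivial
        one.\<close>
      obtain N :: nat and c where N: "N > 0" "\<And>i. i \<in> I \<Longrightarrow> of_nat N * t i = of_int (c i)"
        using common_denominator[OF I, of t] by blast
      have "(\<Sum>i\<in>I. of_int (c i) *s x i) = of_nat N *s v"
        unfolding t scale_sum_right by (intro sum.cong) (simp_all add: N(2)[symmetric])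
      then have "\<forall>i\<in>I. c i = 0" using False \<open>v \<in> W\<close> subspace_scale[OF W] by metis
      then have "\<forall>i\<in>I. t i = 0" using N by force
      then show ?thesis by (simp add: t)
    qed
    moreover have "\<exists>a c. r = a + c \<and> a \<in> R \<inter> W \<and> c \<in> C" if rR: "r \<in> R" for r
    proof -
      obtain t where t: "\<forall>i\<in>I. t i \<in> T" "r - (\<Sum>i\<in>I. t i *s x i) \<in> W" using gen[OF rR] by blast
      then have "(\<Sum>i\<in>I. t i *s x i) \<in> C" unfolding C_def by blast
      then show ?thesis using rR CR t add_subgroup_diff[OF R]
        by (intro exI[of _ "r - (\<Sum>i\<in>I. t i *s x i)"] exI[of _ "\<Sum>i\<in>I. t i *s x i"]) auto
    qed
    ultimately have "direct_sum R (R \<inter> W) C"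
      unfolding direct_sum_def using C R W CR
      by (auto simp: add_subgroup_zero subspace_0 intro!: add_subgroup_Int
          intro: add_subgroup_add subspace_add_subgroup)
    then show ?thesis by blast
  qed
qed

text \<open>The function \<open>f\<close> picks representatives of an injective homomorphism from \<open>M\<close> to \<open>M / H\<close>.\<close>
definition embeds_mod :: "'b set \<Rightarrow> 'b set \<Rightarrow> bool" where
  "embeds_mod M H \<longleftrightarrow> (\<exists>f. (\<forall>x\<in>M. f x \<in> M) \<and> (\<forall>x\<in>M. \<forall>y\<in>M. f (x + y) - f x - f y \<in> H) \<and>
     (\<forall>x\<in>M. f x \<in> H \<longrightarrow> x = 0))"

text \<open>In a subgroup \<open>M\<close> of a rational vector space, \<open>M \<inter> span H\<close> is the pure hull of \<open>H\<close>, the only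
  subgroup that can be a direct summand in which \<open>H\<close> is essential.\<close>
definition pure_Bassian :: "'b set \<Rightarrow> bool" where
  "pure_Bassian M \<longleftrightarrow> (\<forall>H. add_subgroup H \<longrightarrow> H \<subseteq> M \<longrightarrow> embeds_mod M H \<longrightarrow>
     (\<exists>C. direct_sum M (M \<inter> span H) C))"

text \<open>The complement has two layers. Modulo \<open>D\<close>, the group \<open>M\<close>
  becomes \<open>R\<close> and the trace of \<open>U\<close> becomes \<open>R \<inter> W\<close>
  with \<open>W = D + U\<close>, which has a complement \<open>C\<close>. Inside \<open>D\<close>,
  the kernel \<open>D'\<close> of a linear projection onto \<open>D \<inter> U\<close> is a
  complement. The sum \<open>D' + C\<close> then works for \<open>M \<inter> U\<close>.\<close>

lemma pure_splits_divisible_plus_homogeneous: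
  assumes M: "direct_sum M D R" and D: "subspace D" and U: "subspace U"
    and T: "add_subgroup T" and I: "finite I"
    and R: "R = {\<Sum>i\<in>I. t i *s x i | t. \<forall>i\<in>I. t i \<in> T}"
  shows "\<exists>C. direct_sum M (M \<inter> U) C"
proof -
  define W where "W = {d + u | d u. d \<in> D \<and> u \<in> U}"
  have W: "subspace W" unfolding W_def by (rule subspace_sums[OF D U])
  have Rs: "add_subgroup R" using M by (simp add: direct_sum_def)
  have "\<exists>C. direct_sum R (R \<inter> W) C"
  proof (rule finite_type_module_pure_splits[OF T Rs W I, of x])
    fix i t assume "i \<in> I" "t \<in> T"
    then have "t *s x i = (\<Sum>j\<in>I. (if j = i then t else 0) *s x j)"
      using I by (subst sum.remove[of _ i]) auto
    then show "t *s x i \<in> R" unfolding R using \<open>t \<in> T\<close> add_subgroup_zero[OF T]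
      by (auto intro!: exI[of _ "\<lambda>j. if j = i then t else 0"])
  next
    fix r assume "r \<in> R"
    then show "\<exists>t. (\<forall>i\<in>I. t i \<in> T) \<and> r - (\<Sum>i\<in>I. t i *s x i) \<in> W"
      unfolding R using subspace_0[OF W] by auto
  qed
  then obtain C where C: "direct_sum R (R \<inter> W) C" ..
  obtain p where p: "Vector_Spaces.linear scale scale p" "\<And>x. p x \<in> D \<inter> U" "\<And>x. x \<in> D \<inter> U \<Longrightarrow> p x = x"
    using subspace_projection[OF subspace_inter[OF D U]] by blast
  define D' where "D' = {d \<in> D. p d = 0}"
  have D': "add_subgroup D'"
    using p(1) D by (simp add: D'_def add_subgroup_def subspace_0 subspace_diff endo.linear_0 endo.linear_diff)
  have Cs: "add_subgroup C" using C by (simp add: direct_sum_def)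
  define E where "E = {d + c | d c. d \<in> D' \<and> c \<in> C}"
  have D'D: "D' \<subseteq> D" by (auto simp: D'_def)
  have E: "add_subgroup E"
  proof -
    have "u - v \<in> E" if uv: "u \<in> E" "v \<in> E" for u v
    proof -
      obtain d c d' c' where *: "u = d + c" "v = d' + c'" "d \<in> D'" "d' \<in> D'" "c \<in> C" "c' \<in> C"
        using uv unfolding E_def by blast
      then have "u - v = (d - d') + (c - c')" by simp
      then show ?thesis unfolding E_def using * add_subgroup_diff D' Cs by blast
    qed
    moreover have "0 \<in> E" unfolding E_def using add_subgroup_zero[OF D'] add_subgroup_zero[OF Cs] by force
    ultimately show ?thesis by (simp add: add_subgroup_def)
  qed
  have Ms: "add_subgroup M" by (rule direct_sum_add_subgroup[OF M])
  have EM: "E \<subseteq> M"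
    unfolding E_def using D'D direct_sum_left[OF M] direct_sum_right[OF M] direct_sum_right[OF C]
    by (auto intro!: add_subgroup_add[OF Ms])
  have "v = 0" if v: "v \<in> E" "v \<in> U" for v
  proof -
    obtain d c where dc: "v = d + c" "d \<in> D'" "c \<in> C" using v(1) unfolding E_def by blast
    have "c = - d + v" using dc by simp
    then have "c \<in> W" unfolding W_def using v D'D dc subspace_neg[OF D] by blast
    then have "c = 0" using dc direct_sum_right[OF C] by (intro direct_sum_disjoint[OF C]) auto
    then have "d \<in> D \<inter> U" "p d = 0" using dc v D'D by (auto simp: D'_def)
    then show ?thesis using p(3)[of d] dc \<open>c = 0\<close> by auto
  qed
  moreover have "\<exists>a c. v = a + c \<and> a \<in> M \<inter> U \<and> c \<in> E" if v: "v \<in> M" for v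
  proof -
    obtain d r where dr: "d \<in> D" "r \<in> R" "v = d + r" using direct_sum_decomp[OF M v] by blast
    obtain w c where wc: "w \<in> R \<inter> W" "c \<in> C" "r = w + c" using direct_sum_decomp[OF C dr(2)] by blast
    obtain d' u where du: "d' \<in> D" "u \<in> U" "w = d' + u" using wc unfolding W_def by blast
    \<comment> \<open>Replacing \<open>w\<close> by its \<open>U\<close>-part leaves an error
      \<open>d'\<close> in \<open>D\<close>; it is added to the divisible component before
      \<open>p\<close> splits that component.\<close>
    define e where "e = d + d'"
    have e: "e \<in> D" using dr du by (simp add: e_def subspace_add[OF D])
    have "e - p e \<in> D'" using p e subspace_diff[OF D e, of "p e"] by (auto simp: D'_def endo.linear_diff)
    then have "e - p e + c \<in> E" using wc unfolding E_def by blast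
    moreover have veq: "v = (p e + u) + (e - p e + c)" using dr wc du by (simp add: e_def algebra_simps)
    moreover have "p e + u \<in> U" using p(2) du by (auto intro: subspace_add[OF U])
    moreover have "p e + u = v - (e - p e + c)" using veq by (metis add_diff_cancel_right')
    ultimately show ?thesis using EM add_subgroup_diff[OF Ms v] by (metis IntI subsetD)
  qed
  ultimately have "direct_sum M (M \<inter> U) E"
    unfolding direct_sum_def using E EM Ms
    by (auto simp: add_subgroup_zero subspace_0[OF U] intro!: add_subgroup_Int subspace_add_subgroup[OF U]
          intro: add_subgroup_add)
  then show ?thesis by blast
qed

section \<open>Groups of finite rank\<close>

lemma additive_mod_scale:
  assumes H: "add_subgroup H" and M: "add_subgroup M" "x \<in> M"
    and f: "\<And>x y. x \<in> M \<Longrightarrow> y \<in> M \<Longrightarrow> f (x + y) - f x - f y \<in> H"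
  shows "f (of_nat n *s x) - of_nat n *s f x \<in> H"
proof (induction n)
  case 0
  have "- (f (0 + 0) - f 0 - f 0) \<in> H"
    using f[of 0 0] M add_subgroup_uminus[OF H] add_subgroup_zero by blast
  then show ?case by simp
next
  case (Suc n)
  have "f (of_nat (Suc n) *s x) - of_nat (Suc n) *s f x
    = (f (of_nat n *s x + x) - f (of_nat n *s x) - f x) + (f (of_nat n *s x) - of_nat n *s f x)"
    by (simp add: scale_left_distrib algebra_simps)
  also have "\<dots> \<in> H"
    using Suc M by (intro add_subgroup_add[OF H] f add_subgroup_scale_nat)
  finally show ?case .
qed

text \<open>\<open>f\<close> is additive only modulo \<open>H\<close>, so it is replaced by the
  linear map \<open>g\<close> that agrees with it on a basis \<open>Z\<close> of
  \<open>span M\<close>. Modulo \<open>span H\<close> the two coincide on \<open>M\<close>, so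
  \<open>g\<close> is injective modulo \<open>span H\<close>. By dimension \<open>g\<close> maps
  \<open>span Z\<close> onto itself; an element of \<open>H\<close> is therefore some
  \<open>g x\<close>, and then \<open>x = 0\<close>.\<close>

lemma pure_Bassian_finite_dim:
  assumes M: "add_subgroup M" and B: "finite B" "M \<subseteq> span B"
  shows "pure_Bassian M"
  unfolding pure_Bassian_def
proof (intro allI impI)
  fix H assume H: "add_subgroup H" "H \<subseteq> M" and emb: "embeds_mod M H"
  obtain f where F: "(\<forall>x\<in>M. f x \<in> M) \<and> (\<forall>x\<in>M. \<forall>y\<in>M. f (x + y) - f x - f y \<in> H) \<and>
     (\<forall>x\<in>M. f x \<in> H \<longrightarrow> x = 0)"
    using emb unfolding embeds_mod_def by (rule exE)
  have fM: "f x \<in> M" if "x \<in> M" for x using F that by blast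
  have f: "f (x + y) - f x - f y \<in> H" if "x \<in> M" "y \<in> M" for x y using F that by blast
  have finj: "x = 0" if "x \<in> M" "f x \<in> H" for x using F that by blast
  obtain Z where Z: "Z \<subseteq> M" "independent Z" "M \<subseteq> span Z"
    by (rule maximal_independent_subset[of M])
  have finZ: "finite Z" using independent_span_bound[OF B(1) Z(2) order_trans[OF Z(1) B(2)]] by simp
  obtain g where g: "Vector_Spaces.linear scale scale g" "\<And>x. x \<in> Z \<Longrightarrow> g x = f x"
    using endo.linear_independent_extend[OF Z(2)] by blast
  interpret g: Vector_Spaces.linear scale scale g by (rule g(1))
  note fs = additive_mod_scale[OF H(1) M _ f]
  \<comment> \<open>The agreement set of \<open>f\<close> and \<open>g\<close> modulo
    \<open>span H\<close> is a subgroup containing \<open>Z\<close>, so every element of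
    \<open>M\<close> has a multiple in it; since \<open>span H\<close> is a subspace, the factor can
    be divided out.\<close>
  define P where "P = {x \<in> M. f x - g x \<in> span H}"
  have P: "add_subgroup P"
  proof -
    have "0 \<in> P" using fs[OF add_subgroup_zero[OF M], of 0] M
      by (auto simp: P_def add_subgroup_zero g.zero intro: span_base)
    moreover have "x - y \<in> P" if xy: "x \<in> P" "y \<in> P" for x y
    proof -
      have m: "x - y \<in> M" "y \<in> M" using xy by (auto simp: P_def add_subgroup_diff[OF M])
      have "f (x - y) - g (x - y) = (f x - g x) - (f y - g y) - (f (x - y + y) - f (x - y) - f y)"
        by (simp add: g.diff algebra_simps)
      also have "\<dots> \<in> span H" using xy by (intro span_diff[OF span_diff span_base[OF f[OF m]]]) (auto simp: P_def)
      finally show ?thesis using m by (simp add: P_def)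
    qed
    ultimately show ?thesis by (simp add: add_subgroup_def)
  qed
  have ZP: "Z \<subseteq> P" using Z(1) by (auto simp: P_def g(2) span_zero)
  have fg: "f x - g x \<in> span H" if x: "x \<in> M" for x
  proof -
    have "x \<in> span P" using x Z(3) span_mono[OF ZP] by auto
    then obtain n :: nat where n: "n > 0" "of_nat n *s x \<in> P" using span_add_subgroup_multiple[OF P] by blast
    then have "f (of_nat n *s x) - of_nat n *s g x \<in> span H" by (simp add: P_def g.scale)
    then have "(f (of_nat n *s x) - of_nat n *s g x) - (f (of_nat n *s x) - of_nat n *s f x) \<in> span H"
      by (rule span_diff[OF _ span_base[OF fs[OF x]]])
    then have "of_nat n *s (f x - g x) \<in> span H" by (simp add: scale_right_diff_distrib)
    then show ?thesis using n in_subspace_scale_iff[of "span H"] by simp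
  qed
  \<comment> \<open>Two multiples are used: \<open>n\<close> brings \<open>x\<close> into
    \<open>M\<close>, where \<open>f\<close> obeys its laws, and \<open>k\<close> brings the image
    from \<open>span H\<close> into \<open>H\<close>, where injectivity of \<open>f\<close>
    applies.\<close>
  have ginj: "x = 0" if x: "x \<in> span Z" "g x \<in> span H" for x
  proof -
    have "x \<in> span M" using x(1) Z(1) span_mono by blast
    then obtain n :: nat where n: "n > 0" "of_nat n *s x \<in> M" using span_add_subgroup_multiple[OF M] by blast
    let ?y = "of_nat n *s x"
    have "(f ?y - g ?y) + of_nat n *s g x \<in> span H" using fg[OF n(2)] x by (intro span_add span_scale)
    then have "f ?y \<in> span H" by (simp add: g.scale)
    then obtain k :: nat where k: "k > 0" "of_nat k *s f ?y \<in> H" using span_add_subgroup_multiple[OF H(1)] by blast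
    have "(f (of_nat k *s ?y) - of_nat k *s f ?y) + of_nat k *s f ?y \<in> H"
      using fs[OF n(2)] k(2) by (rule add_subgroup_add[OF H(1)])
    then have "of_nat k *s ?y = 0" using finj[of "of_nat k *s ?y"] add_subgroup_scale_nat[OF M n(2)] by simp
    then show ?thesis using k n by simp
  qed
  have inj: "inj_on g (span Z)"
    using ginj span_zero by (subst g.inj_on_iff_eq_0) auto
  have gZ: "independent (g ` Z)" "card (g ` Z) = card Z"
    using g.independent_injective_image[OF Z(2) inj] card_image[OF inj_on_subset[OF inj span_superset]] by auto
  have "h = 0" if h: "h \<in> H" for h
  proof -
    have "h \<in> span (g ` Z)"
    proof (rule ccontr)
      \<comment> \<open>A further independent vector would give \<open>card Z + 1\<close>
        independent vectors in \<open>span Z\<close>.\<close>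
      assume nh: "h \<notin> span (g ` Z)"
      then have "independent (insert h (g ` Z))" using gZ by (intro independent_insertI)
      moreover have "g z \<in> span Z" if "z \<in> Z" for z
        using that Z(1,3) g(2) fM by (metis subsetD)
      then have "insert h (g ` Z) \<subseteq> span Z" using Z(3) h H(2) by blast
      ultimately have "card (insert h (g ` Z)) \<le> card Z" using independent_span_bound[OF finZ] by blast
      then show False using gZ nh finZ span_base[of h "g ` Z"] by (auto simp: card_insert_if split: if_splits)
    qed
    then obtain x where x: "x \<in> span Z" "h = g x" unfolding g.span_image by blast
    then have "x = 0" using h by (intro ginj) (auto intro: span_base)
    then show ?thesis using x g.zero by simp
  qed
  then have "H = {0}" using add_subgroup_zero[OF H(1)] by auto
  then have 0: "M \<inter> span H = {0}" using add_subgroup_zero[OF M] by auto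
  have "direct_sum M (M \<inter> span H) M" unfolding direct_sum_def 0
    using M add_subgroup_zero[OF M] by (auto simp: add_subgroup_def)
  then show "\<exists>C. direct_sum M (M \<inter> span H) C" ..
qed

section \<open>Purity of summands, divisible and reduced parts\<close>

lemma direct_sum_span_components:
  assumes M: "direct_sum M A C" and ac: "a \<in> span A" "c \<in> span C" "a + c \<in> M"
  shows "a \<in> A" "c \<in> C"
proof -
  have AC: "add_subgroup A" "add_subgroup C" using direct_sum_subgroups[OF M] .
  obtain a' c' where ac': "a' \<in> A" "c' \<in> C" "a + c = a' + c'" using direct_sum_decomp[OF M ac(3)] .
  obtain m :: nat where m: "m > 0" "of_nat m *s a \<in> A" using span_add_subgroup_multiple[OF AC(1) ac(1)] .
  obtain n :: nat where n: "n > 0" "of_nat n *s c \<in> C" using span_add_subgroup_multiple[OF AC(2) ac(2)] .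
  \<comment> \<open>One common multiple carries both components into the summands, where
    decompositions are unique; cancelling it afterwards is possible in the vector space.\<close>
  let ?k = "of_nat (n * m) :: rat"
  have k: "?k *s a \<in> A" "?k *s c \<in> C" "?k *s a' \<in> A" "?k *s c' \<in> C"
    using add_subgroup_scale_nat[OF AC(1) m(2), of n] add_subgroup_scale_nat[OF AC(2) n(2), of m]
      add_subgroup_scale_nat[OF AC(1) ac'(1), of "n * m"] add_subgroup_scale_nat[OF AC(2) ac'(2), of "n * m"]
    by (simp_all add: mult.commute)
  have "?k *s a + ?k *s c = ?k *s a' + ?k *s c'"
    using ac'(3) by (metis scale_right_distrib)
  then have "?k *s a = ?k *s a'" "?k *s c = ?k *s c'"
    using direct_sum_unique[OF M k(1,3,2,4)] by auto
  then show "a \<in> A" "c \<in> C" using m n ac' by auto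
qed

lemma direct_sum_right_pure:
  assumes "direct_sum M A C" "x \<in> M" "x \<in> span C"
  shows "x \<in> C"
  using direct_sum_span_components(2)[OF assms(1) span_zero assms(3)] assms(2) by simp

text \<open>For an additive subgroup \<open>M\<close> this is the largest subspace inside
  \<open>M\<close>, that is, its maximal divisible subgroup.\<close>

definition divisible_part :: "'b set \<Rightarrow> 'b set" where
  "divisible_part M = {x. \<forall>q. q *s x \<in> M}"

lemma divisible_part_subset: "divisible_part M \<subseteq> M"
  unfolding divisible_part_def using scale_one by (metis (mono_tags, lifting) mem_Collect_eq subsetI)

lemma subspace_divisible_part: "add_subgroup M \<Longrightarrow> subspace (divisible_part M)"
  by (auto simp: subspace_def divisible_part_def scale_right_distrib add_subgroup_zero add_subgroup_add)

lemma divisible_part_nat: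
  assumes M: "add_subgroup M" and x: "\<And>m::nat. m > 0 \<Longrightarrow> (1 / of_nat m) *s x \<in> M"
  shows "x \<in> divisible_part M"
  unfolding divisible_part_def
proof safe
  fix q :: rat
  obtain a b where ab: "quotient_of q = (a, b)" by (cases "quotient_of q")
  then have b: "b > 0" and q: "q = of_int a / of_int b"
    by (simp_all add: quotient_of_denom_pos quotient_of_div)
  have "of_int a *s (1 / of_nat (nat b)) *s x \<in> M"
    using x[of "nat b"] b by (intro add_subgroup_scale_int M) auto
  then show "q *s x \<in> M" using b q by simp
qed

text \<open>The projection \<open>p\<close> takes its values inside \<open>M\<close>, so
  \<open>x - p x\<close> is again in \<open>M\<close>: a linear splitting of the ambient space
  restricts to \<open>M\<close>.\<close>

lemma direct_sum_divisible_part: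
  assumes M: "add_subgroup M" and p: "Vector_Spaces.linear scale scale p"
    "\<And>x. p x \<in> divisible_part M" "\<And>x. x \<in> divisible_part M \<Longrightarrow> p x = x"
  shows "direct_sum M (divisible_part M) (M \<inter> {x. p x = 0})"
proof -
  interpret p: Vector_Spaces.linear scale scale p by (rule p(1))
  have "\<exists>a c. x = a + c \<and> a \<in> divisible_part M \<and> c \<in> M \<inter> {x. p x = 0}" if x: "x \<in> M" for x
  proof (intro exI conjI)
    show "x = p x + (x - p x)" by simp
    have "p x \<in> M" using p(2) divisible_part_subset by blast
    then show "x - p x \<in> M \<inter> {x. p x = 0}" using x p add_subgroup_diff[OF M] by (simp add: p.diff)
  qed (rule p)
  moreover have "x = 0" if "x \<in> divisible_part M" "p x = 0" for x using p(3)[OF that(1)] that(2) by simp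
  moreover have "add_subgroup (M \<inter> {x. p x = 0})"
    using M by (intro add_subgroup_Int) (auto simp: add_subgroup_def p.diff p.zero)
  moreover have "0 \<in> divisible_part M" "0 \<in> M \<inter> {x. p x = 0}"
    using subspace_0[OF subspace_divisible_part[OF M]] add_subgroup_zero[OF M] p.zero by auto
  moreover have "a + c \<in> M" if "a \<in> divisible_part M" "c \<in> M" for a c
    using that divisible_part_subset add_subgroup_add[OF M] by blast
  ultimately show ?thesis unfolding direct_sum_def
    using subspace_add_subgroup[OF subspace_divisible_part[OF M]] by auto
qed

text \<open>If the reduced part \<open>R\<close> had an infinite basis \<open>Y\<close>, a bijection \<open>Y \<times> \<nat> \<rightarrow> Y\<close> would give a
  linear \<open>\<psi>\<close> mapping \<open>R\<close> onto \<open>span Y\<close>; then \<open>R\<close> embeds in the quotient of \<open>R\<close> by \<open>ker \<psi>\<close>, and a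
  complement of \<open>ker \<psi>\<close> would contain non-zero divisible elements.\<close>
lemma reduced_part_finite_dim:
  assumes M: "add_subgroup M" and sgb: "pure_Bassian M" and p: "Vector_Spaces.linear scale scale p"
    "\<And>x. p x \<in> divisible_part M" "\<And>x. x \<in> divisible_part M \<Longrightarrow> p x = x"
  shows "\<exists>B. finite B \<and> M \<inter> {x. p x = 0} \<subseteq> span B"
proof -
  interpret p: Vector_Spaces.linear scale scale p by (rule p(1))
  define R where "R = M \<inter> {x. p x = 0}"
  note ds = direct_sum_divisible_part[OF M p, folded R_def]
  have R: "add_subgroup R" using direct_sum_subgroups[OF ds] by simp
  obtain Y where Y: "Y \<subseteq> R" "independent Y" "R \<subseteq> span Y"
    by (rule maximal_independent_subset[of R])
  have "finite Y"
  proof (rule ccontr)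
    assume inf: "infinite Y"
    then have "|Y \<times> (UNIV :: nat set)| =o |Y|"
      using infinite_iff_card_of_nat by (intro card_of_Times_infinite_simps) auto
    then obtain b where b: "bij_betw b (Y \<times> (UNIV :: nat set)) Y" using card_of_ordIso by blast
    \<comment> \<open>Each \<open>y\<close> in \<open>Y\<close> owns countably many basis vectors
      \<open>b (y, m)\<close>, sent to the fractions \<open>y / (m + 1)\<close>. The shift keeps
      denominators non-zero, and all positive denominators occur.\<close>
    obtain \<psi> where \<psi>: "Vector_Spaces.linear scale scale \<psi>"
      and \<psi>Y: "\<forall>z\<in>Y. \<psi> z = (case inv_into (Y \<times> UNIV) b z of (y, m) \<Rightarrow> (1 / of_nat (Suc m)) *s y)"
      using endo.linear_independent_extend[OF Y(2),
          of "\<lambda>z. case inv_into (Y \<times> UNIV) b z of (y, m) \<Rightarrow> (1 / of_nat (Suc m)) *s y"]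
      by blast
    interpret \<psi>: Vector_Spaces.linear scale scale \<psi> by (rule \<psi>)
    have bY: "b (y, m) \<in> Y" if "y \<in> Y" for y m
      using bij_betwE[OF b] that by auto
    have \<psi>b: "\<psi> (b (y, m)) = (1 / of_nat (Suc m)) *s y" if "y \<in> Y" for y m
      using \<psi>Y bY[OF that] that bij_betw_inv_into_left[OF b, of "(y, m)"] by auto
    have surj: "\<exists>s\<in>R. \<psi> s = x" if "x \<in> span Y" for x
      using that
    proof (induction rule: span_induct_alt)
      case base
      then show ?case using add_subgroup_zero[OF R] \<psi>.zero by blast
    next
      case (step q y x)
      then obtain s where s: "s \<in> R" "\<psi> s = x" by blast
      obtain k l where kl: "quotient_of q = (k, l)" by (cases "quotient_of q")
      then have l: "l > 0" and q: "q = of_int k / of_int l"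
        by (simp_all add: quotient_of_denom_pos quotient_of_div)
      \<comment> \<open>With the shifted index, \<open>nat l - 1\<close> is the position whose image
        is \<open>y / l\<close>.\<close>
      define z where "z = of_int k *s b (y, nat l - 1)"
      have "z \<in> R" unfolding z_def using bY[OF step(1)] Y(1) by (intro add_subgroup_scale_int[OF R]) auto
      moreover have "\<psi> z = q *s y" using l by (simp add: z_def \<psi>.scale \<psi>b[OF step(1)] q)
      ultimately show ?case using s add_subgroup_add[OF R] by (intro bexI[of _ "z + s"]) (auto simp: \<psi>.add)
    qed
    then have "\<forall>x\<in>R. \<exists>s. s \<in> R \<and> \<psi> s = x" using Y(3) by blast
    then obtain s where s: "\<And>x. x \<in> R \<Longrightarrow> s x \<in> R" "\<And>x. x \<in> R \<Longrightarrow> \<psi> (s x) = x" by metis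
    define K where "K = R \<inter> {x. \<psi> x = 0}"
    have K: "add_subgroup K" unfolding K_def
      using R by (intro add_subgroup_Int) (auto simp: add_subgroup_def \<psi>.diff \<psi>.zero)
    have KR: "K \<subseteq> R" and RM: "R \<subseteq> M" by (auto simp: K_def R_def)
    \<comment> \<open>\<open>K\<close> is cut out of \<open>M\<close> by linear equations, so it is
      its own pure hull.\<close>
    have "span K \<subseteq> {x. p x = 0} \<inter> {x. \<psi> x = 0}"
      by (intro span_minimal subspace_inter p.subspace_kernel \<psi>.subspace_kernel) (auto simp: K_def R_def)
    then have MK: "M \<inter> span K = K" using span_superset[of K] by (auto simp: K_def R_def)
    have red: "x - p x \<in> R" if "x \<in> M" for x
      using add_subgroup_diff[OF M that subsetD[OF divisible_part_subset p(2)]] p(2,3)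
      unfolding R_def by (simp add: p.diff)
    have "embeds_mod M K"
      unfolding embeds_mod_def
    \<comment> \<open>The embedding is the identity on the divisible part and a chosen section of
      \<open>\<psi>\<close> on the reduced part. The section need not be additive, but its defects
      are killed by \<open>\<psi>\<close> and so lie in \<open>K\<close>.\<close>
    proof (intro exI[of _ "\<lambda>x. p x + s (x - p x)"] conjI ballI impI)
      fix x assume x: "x \<in> M"
      show "p x + s (x - p x) \<in> M"
        using p(2) divisible_part_subset s(1)[OF red[OF x]] RM by (intro add_subgroup_add[OF M]) auto
      assume "p x + s (x - p x) \<in> K"
      then have "p (p x + s (x - p x)) = 0" and 0: "\<psi> (p x + s (x - p x)) = 0" by (auto simp: K_def R_def)
      moreover have "p (s (x - p x)) = 0" using s(1)[OF red[OF x]] by (simp add: R_def)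
      ultimately have "p x = 0" using p(2,3) by (simp add: p.add)
      then show "x = 0" using 0 s(2)[OF red[OF x]] by simp
    next
      fix x y assume xy: "x \<in> M" "y \<in> M"
      have xyR: "x + y - p (x + y) \<in> R" using red xy add_subgroup_add[OF M] by blast
      have eq: "p (x + y) + s (x + y - p (x + y)) - (p x + s (x - p x)) - (p y + s (y - p y))
        = s (x + y - p (x + y)) - s (x - p x) - s (y - p y)"
        by (simp add: p.add)
      have "s (x + y - p (x + y)) - s (x - p x) - s (y - p y) \<in> R"
        using s(1) red xy xyR by (intro add_subgroup_diff[OF R]) auto
      moreover have "\<psi> (s (x + y - p (x + y)) - s (x - p x) - s (y - p y)) = 0"
        using s(2) red xy xyR by (simp add: \<psi>.diff p.add)
      ultimately show "p (x + y) + s (x + y - p (x + y)) - (p x + s (x - p x)) - (p y + s (y - p y)) \<in> K"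
        unfolding eq K_def by simp
    qed
    then obtain C where C: "direct_sum M K C"
      using sgb K KR RM MK unfolding pure_Bassian_def by (metis order_trans)
    obtain y where y: "y \<in> Y" using inf by (metis finite.emptyI ex_in_conv)
    let ?z = "\<lambda>m. b (y, m)"
    have zM: "?z m \<in> M" for m using bY[OF y] Y(1) RM by blast
    obtain a c where ac: "a \<in> K" "c \<in> C" "?z 0 = a + c" using direct_sum_decomp[OF C zM] .
    have "(1 / of_nat m) *s c \<in> M" if m: "m > 0" for m :: nat
    proof -
      obtain a' c' where ac': "a' \<in> K" "c' \<in> C" "?z (m - 1) = a' + c'" using direct_sum_decomp[OF C zM] .
      \<comment> \<open>\<open>\<psi>\<close> sends \<open>?z 0\<close> to \<open>y\<close> and
        \<open>?z (m - 1)\<close> to \<open>y / m\<close>, so \<open>?z 0\<close> and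
        \<open>m\<close> times \<open>?z (m - 1)\<close> agree modulo \<open>K\<close>. Their
        components in \<open>C\<close> therefore agree, and \<open>c\<close> is divisible by every
        \<open>m\<close>.\<close>
      have "?z 0 - of_nat m *s ?z (m - 1) \<in> R"
        using bY[OF y] Y(1) by (intro add_subgroup_diff[OF R] add_subgroup_scale_nat[OF R]) auto
      then have k: "?z 0 - of_nat m *s ?z (m - 1) \<in> K"
        using m \<psi>b[OF y] by (simp add: K_def \<psi>.diff \<psi>.scale)
      have "a + c = (?z 0 - of_nat m *s ?z (m - 1) + of_nat m *s a') + of_nat m *s c'"
        using ac ac' by (simp add: scale_right_distrib)
      moreover have "?z 0 - of_nat m *s ?z (m - 1) + of_nat m *s a' \<in> K"
        using k ac'(1) by (intro add_subgroup_add[OF K] add_subgroup_scale_nat[OF K])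
      moreover have "of_nat m *s c' \<in> C"
        using ac'(2) direct_sum_subgroups[OF C] add_subgroup_scale_nat by blast
      ultimately have "c = of_nat m *s c'" using direct_sum_unique(2)[OF C ac(1) _ ac(2)] by blast
      then have "(1 / of_nat m) *s c = c'" using m by simp
      then show ?thesis using direct_sum_right[OF C ac'(2)] by simp
    qed
    then have "c \<in> divisible_part M" by (rule divisible_part_nat[OF M])
    then have "p c = c" by (rule p)
    \<comment> \<open>\<open>c\<close> is a difference of elements of the reduced part, so being
      divisible it vanishes; then \<open>?z 0\<close> lies in \<open>K\<close>, although its image
      under \<open>\<psi>\<close> is \<open>y\<close>.\<close>
    moreover have "p c = 0"
    proof -
      have "?z 0 \<in> R" "a \<in> R" using ac(1) bY[OF y, of 0] Y(1) KR by blast+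
      then show ?thesis using p.add[of a c] ac(3) by (simp add: R_def)
    qed
    ultimately have "?z 0 \<in> K" using ac by simp
    then have "\<psi> (?z 0) = 0" by (simp add: K_def)
    then have "y = 0" using \<psi>b[OF y, of 0] by simp
    then show False using y Y(2) dependent_zero by blast
  qed
  then show ?thesis using Y(3) unfolding R_def by blast
qed

section \<open>Groups whose pure subgroups are all summands\<close>

definition all_pure_split :: "'b set \<Rightarrow> bool" where
  "all_pure_split R \<longleftrightarrow> (\<forall>H. H \<subseteq> R \<longrightarrow> (\<exists>C. direct_sum R (R \<inter> span H) C))"

text \<open>As \<open>D\<close> has infinite rank and the reduced part finite rank, \<open>M\<close>
  and \<open>D\<close> have the same rank, and \<open>M\<close> maps injectively into the subspace
  \<open>D\<close>. The pure hull \<open>A\<close> of \<open>H\<close> in the reduced part meets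
  \<open>D\<close> in 0, so the same map witnesses \<open>embeds_mod M A\<close>. The resulting
  splitting of \<open>M\<close> is restricted by the modular law.\<close>

lemma reduced_part_all_pure_split:
  assumes sgb: "pure_Bassian M" and M: "direct_sum M D (M \<inter> W)" and D: "subspace D" and W: "subspace W"
    and inf: "\<not> (\<exists>B. finite B \<and> D \<subseteq> span B)" and fin: "finite B" "M \<inter> W \<subseteq> span B"
  shows "all_pure_split (M \<inter> W)"
  unfolding all_pure_split_def
proof (intro allI impI)
  fix H assume H: "H \<subseteq> M \<inter> W"
  have Ms: "add_subgroup M" by (rule direct_sum_add_subgroup[OF M])
  obtain E where E: "E \<subseteq> D" "independent E" "D \<subseteq> span E"
    by (rule maximal_independent_subset[of D])
  have infE: "infinite E" using inf E(3) by blast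
  obtain Z where Z: "E \<subseteq> Z" "Z \<subseteq> E \<union> B" "independent Z" "E \<union> B \<subseteq> span Z"
    by (rule maximal_independent_subset_extend[OF Un_upper1 E(2)])
  \<comment> \<open>Extending the basis \<open>E\<close> of \<open>D\<close> to one of
    \<open>D + span B\<close> adds only finitely many vectors, which does not change the infinite
    cardinality.\<close>
  have "|Z - E| <o |E|"
    using infE fin(1) Z(2) by (intro finite_ordLess_infinite2) (auto intro: finite_subset[of _ B])
  then have "|E \<union> (Z - E)| =o |E|"
    using infE by (intro card_of_Un_infinite[THEN conjunct1] ordLess_imp_ordLeq)
  then have "|Z| =o |E|" using Z(1) by (simp add: Un_absorb1)
  then obtain h where h: "bij_betw h Z E" using card_of_ordIso by blast
  obtain g where g: "Vector_Spaces.linear scale scale g" "\<forall>z\<in>Z. g z = h z"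
    using endo.linear_independent_extend[OF Z(3), of h] by blast
  interpret g: Vector_Spaces.linear scale scale g by (rule g(1))
  have gZ: "g ` Z = E" using h g(2) by (auto simp: bij_betw_def)
  have "inj_on g Z" using h g(2) by (simp add: bij_betw_def inj_on_def)
  then have inj: "inj_on g (span Z)"
    using E(2) gZ g.inj_on_span_iff_independent_image[of Z] by simp
  have "span E \<subseteq> D" by (rule span_minimal[OF E(1) D])
  then have gD: "g x \<in> D" if "x \<in> span Z" for x
    using g.span_image[of Z] gZ that by blast
  have MZ: "M \<subseteq> span Z"
  proof
    fix x assume "x \<in> M"
    then obtain d r where dr: "d \<in> D" "r \<in> M \<inter> W" "x = d + r" using direct_sum_decomp[OF M] by blast
    have "span (E \<union> B) \<subseteq> span Z" using span_minimal[OF Z(4)] by simp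
    moreover have "d \<in> span (E \<union> B)" "r \<in> span (E \<union> B)"
      using dr E(3) fin(2) span_mono[of E "E \<union> B"] span_mono[of B "E \<union> B"] by auto
    ultimately show "x \<in> span Z" using dr(3) span_add by blast
  qed
  define A where "A = M \<inter> W \<inter> span H"
  have A: "add_subgroup A" "A \<subseteq> M"
    unfolding A_def by (auto simp: add_subgroup_Int Ms subspace_add_subgroup W)
  have "embeds_mod M A"
    unfolding embeds_mod_def
  proof (intro exI[of _ g] conjI ballI impI)
    fix x assume x: "x \<in> M"
    then have gx: "g x \<in> D" using gD MZ by blast
    then show "g x \<in> M" by (rule direct_sum_left[OF M])
    assume "g x \<in> A"
    then have "g x = 0" using direct_sum_disjoint[OF M gx] by (simp add: A_def)
    then show "x = 0" using inj_onD[OF inj, of x 0] x MZ span_zero g.zero by auto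
  next
    fix x y
    show "g (x + y) - g x - g y \<in> A" using add_subgroup_zero[OF A(1)] by (simp add: g.add)
  qed
  then obtain C where C: "direct_sum M (M \<inter> span A) C"
    using sgb A unfolding pure_Bassian_def by blast
  have "span A \<subseteq> W \<inter> span H"
    by (intro span_minimal subspace_inter W subspace_span) (auto simp: A_def)
  then have "M \<inter> span A = A" using span_superset[of A] by (auto simp: A_def)
  then have "direct_sum (M \<inter> W) A (C \<inter> (M \<inter> W))"
    using C by (intro direct_sum_modular[of M]) (auto simp: A_def add_subgroup_Int Ms subspace_add_subgroup W)
  then show "\<exists>C. direct_sum (M \<inter> W) (M \<inter> W \<inter> span H) C" unfolding A_def by blast
qed

text \<open>A summand \<open>C\<close> is pure, so the pure hull of a subset of \<open>C\<close> is
  the same in \<open>C\<close> as in \<open>R\<close>; its complement in \<open>R\<close> restricts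
  to \<open>C\<close> by the modular law.\<close>

lemma all_pure_split_summand:
  assumes R: "all_pure_split R" and C: "direct_sum R A C"
  shows "all_pure_split C"
  unfolding all_pure_split_def
proof (intro allI impI)
  fix H assume H: "H \<subseteq> C"
  have CR: "C \<subseteq> R" using direct_sum_right[OF C] by blast
  then obtain C' where C': "direct_sum R (R \<inter> span H) C'"
    using R H unfolding all_pure_split_def by (metis order_trans)
  have "R \<inter> span H = C \<inter> span H"
    using direct_sum_right_pure[OF C] span_mono[OF H] CR by blast
  then have "direct_sum C (C \<inter> span H) (C' \<inter> C)"
    using direct_sum_modular[OF C', of C] direct_sum_subgroups(2)[OF C] CR by auto
  then show "\<exists>D. direct_sum C (C \<inter> span H) D" by blast
qed

text \<open>The pure hull of one non-zero element is split off, and the complement has smaller rank.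
  Requiring each term \<open>q z *s z\<close> to lie in \<open>R\<close> makes \<open>R\<close> the
  direct sum of its intersections with the lines through \<open>Z\<close>, not merely a subgroup of
  their span.\<close>

lemma all_pure_split_decomposition:
  assumes "finite B" "R \<subseteq> span B" "all_pure_split R" "add_subgroup R"
  shows "\<exists>Z. finite Z \<and> independent Z \<and> Z \<subseteq> R \<and>
    (\<forall>r\<in>R. \<exists>q. r = (\<Sum>z\<in>Z. q z *s z) \<and> (\<forall>z\<in>Z. q z *s z \<in> R))"
  using assms
proof (induction "card B" arbitrary: B R rule: less_induct)
  case less
  show ?case
  proof (cases "R \<subseteq> {0}")
    case True
    then show ?thesis by (intro exI[of _ "{}"]) (auto simp: independent_empty)
  next
    case False
    then obtain z where z: "z \<in> R" "z \<noteq> 0" by blast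
    then obtain C where C: "direct_sum R (R \<inter> span {z}) C"
      using less.prems(3) unfolding all_pure_split_def by blast
    have CR: "C \<subseteq> R" using direct_sum_right[OF C] by blast
    have Cs: "add_subgroup C" using direct_sum_subgroups[OF C] by simp
    have zC: "z \<notin> span C"
    proof
      assume "z \<in> span C"
      then have "z \<in> C" using direct_sum_right_pure[OF C z(1)] by simp
      then show False using direct_sum_disjoint[OF C _ \<open>z \<in> C\<close>] z span_base by auto
    qed
    obtain E where E: "E \<subseteq> C" "independent E" "C \<subseteq> span E"
      by (rule maximal_independent_subset[of C])
    have zE: "z \<notin> span E" using zC span_mono[OF E(1)] by blast
    then have "independent (insert z E)" using E(2) by (intro independent_insertI)
    \<comment> \<open>\<open>z\<close> is independent of the basis \<open>E\<close> of
      \<open>C\<close>, so \<open>E\<close> has fewer elements than \<open>B\<close>;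
      \<open>E\<close> is the bounding set for the induction.\<close>
    moreover have "insert z E \<subseteq> span B" using z E(1) CR less.prems(2) by blast
    ultimately have fE: "finite (insert z E) \<and> card (insert z E) \<le> card B"
      by (rule independent_span_bound[OF less.prems(1)])
    moreover have "z \<notin> E" using zE span_base by blast
    ultimately have "finite E" "card E < card B" by auto
    from less.hyps[OF this(2) this(1) E(3) all_pure_split_summand[OF less.prems(3) C] Cs]
    obtain Z where Z: "finite Z" "independent Z" "Z \<subseteq> C"
      "\<forall>r\<in>C. \<exists>q. r = (\<Sum>z\<in>Z. q z *s z) \<and> (\<forall>z\<in>Z. q z *s z \<in> C)"
      by (elim exE conjE)
    have zZ: "z \<notin> span Z" "z \<notin> Z" using zC span_mono[OF Z(3)] span_base[of z C] Z(3) by auto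
    show ?thesis
    proof (intro exI[of _ "insert z Z"] conjI ballI)
      show "independent (insert z Z)" using zZ Z(2) by (intro independent_insertI)
      fix r assume r: "r \<in> R"
      obtain a c where ac: "a \<in> R \<inter> span {z}" "c \<in> C" "r = a + c" using direct_sum_decomp[OF C r] .
      obtain k where k: "a = k *s z" using ac(1) unfolding span_singleton by auto
      obtain q where q: "c = (\<Sum>z\<in>Z. q z *s z)" "\<forall>z\<in>Z. q z *s z \<in> C" using Z(4) ac(2) by blast
      have "(\<Sum>x\<in>Z. (q(z := k)) x *s x) = c" unfolding q(1) using zZ by (intro sum.cong) auto
      then have "r = (\<Sum>x\<in>insert z Z. (q(z := k)) x *s x)"
        using zZ Z(1) ac(3) k by simp
      moreover have "\<forall>x\<in>insert z Z. (q(z := k)) x *s x \<in> R" using q(2) k ac(1) CR by auto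
      ultimately show "\<exists>q. r = (\<Sum>z\<in>insert z Z. q z *s z) \<and> (\<forall>z\<in>insert z Z. q z *s z \<in> R)" by blast
    qed (use Z(1,3) z(1) CR in auto)
  qed
qed

text \<open>For \<open>y / p \<notin> R\<close> and \<open>x\<close> in a complement of the pure hull of \<open>y\<close>, the pure hull of \<open>p x + y\<close>
  is a summand; projecting \<open>y\<close> onto it and then onto \<open>x\<close> compares the divisors of \<open>y\<close> and \<open>x\<close>.
  The projection cannot vanish, since otherwise \<open>x + y / p \<in> R\<close>.\<close>
lemma all_pure_split_homogeneous:
  assumes R: "add_subgroup R" and split: "all_pure_split R" and red: "divisible_part R \<subseteq> {0}"
    and y: "y \<in> R" "y \<noteq> 0" and z: "z \<in> R"
  shows "\<exists>k::nat. k > 0 \<and> (\<forall>m::nat. m > 0 \<longrightarrow> (1 / of_nat m) *s y \<in> R \<longrightarrow> (of_nat k / of_nat m) *s z \<in> R)"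
proof -
  have "y \<notin> divisible_part R" using red y(2) by blast
  \<comment> \<open>As \<open>R\<close> is reduced, some positive \<open>p\<close>, not necessarily
    prime, does not divide \<open>y\<close> in \<open>R\<close>.\<close>
  then obtain p :: nat where p: "p > 0" "(1 / of_nat p) *s y \<notin> R" using divisible_part_nat[OF R] by blast
  obtain C where C: "direct_sum R (R \<inter> span {y}) C" using split y(1) unfolding all_pure_split_def by blast
  obtain t x where tx: "t \<in> R \<inter> span {y}" "x \<in> C" "z = t + x" using direct_sum_decomp[OF C z] .
  have xR: "x \<in> R" by (rule direct_sum_right[OF C tx(2)])
  \<comment> \<open>A non-zero rational factor \<open>\<alpha>\<close> is as good as a positive
    integer: multiplying by its denominator and its sign leaves \<open>\<bar>a\<bar>\<close>,
    independently of \<open>m\<close>.\<close>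
  have scaled: "\<exists>k::nat. k > 0 \<and> (\<forall>m::nat. m > 0 \<longrightarrow> (1 / of_nat m) *s y \<in> R \<longrightarrow> (of_nat k / of_nat m) *s w \<in> R)"
    if \<alpha>: "\<alpha> \<noteq> 0" "\<And>m::nat. m > 0 \<Longrightarrow> (1 / of_nat m) *s y \<in> R \<Longrightarrow> (\<alpha> / of_nat m) *s w \<in> R" for \<alpha> w
  proof -
    obtain a b where ab: "quotient_of \<alpha> = (a, b)" by (cases "quotient_of \<alpha>")
    then have b: "b > 0" and q: "\<alpha> = of_int a / of_int b"
      by (simp_all add: quotient_of_denom_pos quotient_of_div)
    have a: "a \<noteq> 0" using \<alpha> q by auto
    have "(of_nat (nat \<bar>a\<bar>) / of_nat m) *s w \<in> R" if m: "m > 0" "(1 / of_nat m) *s y \<in> R" for m :: nat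
    proof -
      have "of_int (sgn a * b) *s (\<alpha> / of_nat m) *s w \<in> R"
        using add_subgroup_scale_int[OF R \<alpha>(2)[OF m]] .
      moreover have "of_int (sgn a * b) * (\<alpha> / of_nat m) = of_nat (nat \<bar>a\<bar>) / of_nat m"
        using b m(1) by (simp add: q sgn_if abs_if)
      ultimately show ?thesis by (simp only: scale_scale)
    qed
    then show ?thesis using a by (intro exI[of _ "nat \<bar>a\<bar>"]) auto
  qed
  have x: "\<exists>k::nat. k > 0 \<and> (\<forall>m::nat. m > 0 \<longrightarrow> (1 / of_nat m) *s y \<in> R \<longrightarrow> (of_nat k / of_nat m) *s x \<in> R)"
  proof (cases "x = 0")
    case True
    then show ?thesis using add_subgroup_zero[OF R] by (intro exI[of _ 1]) auto
  next
    case False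
    define v where "v = of_nat p *s x + y"
    have vR: "v \<in> R" unfolding v_def using xR y(1) by (intro add_subgroup_add[OF R] add_subgroup_scale_nat[OF R])
    obtain C' where C': "direct_sum R (R \<inter> span {v}) C'" using split vR unfolding all_pure_split_def by blast
    have v_mem: "v \<in> R \<inter> span {v}" using vR span_base by blast
    have v0: "v \<noteq> 0"
    proof
      assume "v = 0"
      then have "of_nat p *s x = - y" unfolding v_def by (simp add: add_eq_0_iff2)
      then have "(1 / of_nat p) *s of_nat p *s x = (1 / of_nat p) *s (- y)" by simp
      then have "x = (1 / of_nat p) *s (- y)" using p(1) by simp
      then have "x \<in> R \<inter> span {y}" using xR span_scale[OF span_neg[OF span_base[of y "{y}"]]] by auto
      then show False using direct_sum_disjoint[OF C _ tx(2)] False by blast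
    qed
    obtain u c where uc: "u \<in> R \<inter> span {v}" "c \<in> C'" "y = u + c" using direct_sum_decomp[OF C' y(1)] .
    obtain s where s: "u = s *s v" using uc(1) unfolding span_singleton by auto
    \<comment> \<open>\<open>s\<close> measures the projection of \<open>y\<close> to the line of
      \<open>v\<close>. If it is non-zero, \<open>y / m\<close> projects to \<open>s v / m\<close>,
      whose component in \<open>C\<close> is a fixed multiple of \<open>x / m\<close>.\<close>
    show ?thesis
    proof (cases "s = 0")
      case False
      show ?thesis
      proof (rule scaled[of "s * of_nat p"])
        show "s * of_nat p \<noteq> 0" using False p(1) by simp
        fix m :: nat assume m: "m > 0" "(1 / of_nat m) *s y \<in> R"
        have "(1 / of_nat m) *s u + (1 / of_nat m) *s c \<in> R"
          using m(2) uc(3) by (simp add: scale_right_distrib)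
        then have "(1 / of_nat m) *s u \<in> R \<inter> span {v}"
          using uc(1,2) by (intro direct_sum_span_components(1)[OF C', of _ "(1 / of_nat m) *s c"] span_scale)
            (auto intro: span_base)
        then have "(s / of_nat m) *s y + (s * of_nat p / of_nat m) *s x \<in> R"
          using s by (simp add: v_def scale_right_distrib add.commute mult.commute)
        then have "(s * of_nat p / of_nat m) *s x \<in> C"
          using tx(2) y(1) by (intro direct_sum_span_components(2)[OF C, of "(s / of_nat m) *s y"] span_scale)
            (auto intro: span_base)
        then show "(s * of_nat p / of_nat m) *s x \<in> R" by (rule direct_sum_right[OF C])
      qed
    next
      case True
      then have yC': "y \<in> C'" using uc s by simp
      obtain w e where we: "w \<in> R \<inter> span {v}" "e \<in> C'" "x = w + e" using direct_sum_decomp[OF C' xR] .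
      obtain \<sigma> where \<sigma>: "w = \<sigma> *s v" using we(1) unfolding span_singleton by auto
      have e: "(1 - \<sigma> * of_nat p) *s x = e + \<sigma> *s y"
        using we(3) unfolding \<sigma> v_def by (simp add: scale_right_distrib scale_left_diff_distrib algebra_simps)
      show ?thesis
      \<comment> \<open>Now \<open>y\<close> lies in \<open>C'\<close>. If the factor of
        \<open>x\<close> in \<open>e\<close> is non-zero, \<open>x\<close> and hence
        \<open>v\<close> fall into \<open>span C'\<close>, against \<open>v \<noteq> 0\<close>. If
        it is zero, then \<open>w = x + y / p\<close>, so \<open>y / p\<close> would lie in
        \<open>R\<close>.\<close>
      proof (cases "\<sigma> * of_nat p = 1")
        case False
        have "(1 - \<sigma> * of_nat p) *s x \<in> span C'"
          unfolding e using we(2) yC' by (intro span_add span_scale) (auto intro: span_base)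
        then have "x \<in> span C'" using False in_subspace_scale_iff[of "span C'" "1 - \<sigma> * of_nat p" x] by auto
        then have "v \<in> span C'" unfolding v_def using yC' by (intro span_add span_scale) (auto intro: span_base)
        then have "v \<in> C'" by (rule direct_sum_right_pure[OF C' vR])
        then show ?thesis using direct_sum_disjoint[OF C' v_mem] v0 by blast
      next
        case True
        then have "\<sigma> = 1 / of_nat p" using p(1) by (simp add: field_simps)
        then have "w - x = (1 / of_nat p) *s y" using p(1) by (simp add: \<sigma> v_def scale_right_distrib)
        then show ?thesis using p(2) add_subgroup_diff[OF R _ xR, of w] we(1) by simp
      qed
    qed
  qed
  obtain \<tau> where \<tau>: "t = \<tau> *s y" using tx(1) unfolding span_singleton by auto
  have t: "\<exists>k::nat. k > 0 \<and> (\<forall>m::nat. m > 0 \<longrightarrow> (1 / of_nat m) *s y \<in> R \<longrightarrow> (of_nat k / of_nat m) *s t \<in> R)"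
  proof (cases "\<tau> = 0")
    case True
    then show ?thesis using add_subgroup_zero[OF R] \<tau> by (intro exI[of _ 1]) auto
  next
    case False
    then show ?thesis using \<tau> by (intro scaled[of "1 / \<tau>"]) auto
  qed
  obtain k :: nat where k: "k > 0" "\<And>m::nat. m > 0 \<Longrightarrow> (1 / of_nat m) *s y \<in> R \<Longrightarrow> (of_nat k / of_nat m) *s x \<in> R"
    using x by blast
  obtain l :: nat where l: "l > 0" "\<And>m::nat. m > 0 \<Longrightarrow> (1 / of_nat m) *s y \<in> R \<Longrightarrow> (of_nat l / of_nat m) *s t \<in> R"
    using t by blast
  have "(of_nat (k * l) / of_nat m) *s z \<in> R" if m: "m > 0" "(1 / of_nat m) *s y \<in> R" for m :: nat
  proof -
    have "(of_nat (k * l) / of_nat m) *s z =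
      of_nat k *s (of_nat l / of_nat m) *s t + of_nat l *s (of_nat k / of_nat m) *s x"
      by (simp add: tx(3) scale_right_distrib mult.commute)
    then show ?thesis using k(2)[OF m] l(2)[OF m]
      by (simp add: add_subgroup_add[OF R] add_subgroup_scale_nat[OF R] del: scale_scale)
  qed
  then show ?thesis using k(1) l(1) by (intro exI[of _ "k * l"]) auto
qed

text \<open>The last clause bounds the type of \<open>y\<close> by that of \<open>z\<close>; applied
  in both orders to non-zero elements it yields homogeneity.\<close>

lemma pure_Bassian_structure:
  assumes M: "add_subgroup M" and sgb: "pure_Bassian M" and inf: "\<not> (\<exists>B. finite B \<and> M \<subseteq> span B)"
  shows "\<exists>D R. direct_sum M D R \<and> subspace D \<and> \<not> (\<exists>B. finite B \<and> D \<subseteq> span B) \<and>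
    (\<exists>Z. finite Z \<and> independent Z \<and> Z \<subseteq> R \<and>
      (\<forall>r\<in>R. \<exists>q. r = (\<Sum>z\<in>Z. q z *s z) \<and> (\<forall>z\<in>Z. q z *s z \<in> R))) \<and>
    (\<forall>y\<in>R. \<forall>z\<in>R. y \<noteq> 0 \<longrightarrow> (\<exists>k::nat. k > 0 \<and>
      (\<forall>m::nat. m > 0 \<longrightarrow> (1 / of_nat m) *s y \<in> R \<longrightarrow> (of_nat k / of_nat m) *s z \<in> R)))"
proof -
  have D: "subspace (divisible_part M)" by (rule subspace_divisible_part[OF M])
  obtain p where p: "Vector_Spaces.linear scale scale p"
    "\<And>x. p x \<in> divisible_part M" "\<And>x. x \<in> divisible_part M \<Longrightarrow> p x = x"
    using subspace_projection[OF D] by blast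
  interpret p: Vector_Spaces.linear scale scale p by (rule p(1))
  let ?D = "divisible_part M" and ?W = "{x. p x = 0}"
  have ds: "direct_sum M ?D (M \<inter> ?W)" by (rule direct_sum_divisible_part[OF M p])
  obtain B where B: "finite B" "M \<inter> ?W \<subseteq> span B" using reduced_part_finite_dim[OF M sgb p] by blast
  have infD: "\<not> (\<exists>B. finite B \<and> ?D \<subseteq> span B)"
  proof
    assume "\<exists>B. finite B \<and> ?D \<subseteq> span B"
    then obtain B' where B': "finite B'" "?D \<subseteq> span B'" by blast
    have "x \<in> span (B \<union> B')" if "x \<in> M" for x
    proof -
      obtain d r where dr: "d \<in> ?D" "r \<in> M \<inter> ?W" "x = d + r" using direct_sum_decomp[OF ds \<open>x \<in> M\<close>] .
      have "d \<in> span (B \<union> B')" "r \<in> span (B \<union> B')"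
        using dr B(2) B'(2) span_mono[of B "B \<union> B'"] span_mono[of B' "B \<union> B'"] by blast+
      then show ?thesis using dr(3) span_add by blast
    qed
    then show False using inf B(1) B'(1) by (metis finite_UnI subsetI)
  qed
  have split: "all_pure_split (M \<inter> ?W)"
    by (rule reduced_part_all_pure_split[OF sgb ds D p.subspace_kernel infD B])
  have R: "add_subgroup (M \<inter> ?W)" using direct_sum_subgroups[OF ds] by simp
  have red: "divisible_part (M \<inter> ?W) \<subseteq> {0}"
  proof
    fix x assume x: "x \<in> divisible_part (M \<inter> ?W)"
    then have "x \<in> ?D" by (auto simp: divisible_part_def)
    moreover have "x \<in> M \<inter> ?W" using x divisible_part_subset by blast
    ultimately show "x \<in> {0}" using direct_sum_disjoint[OF ds] by blast
  qed
  show ?thesis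
    using ds D infD all_pure_split_decomposition[OF B split R] all_pure_split_homogeneous[OF R split red]
    by blast
qed

section \<open>Coprime denominators and characteristics\<close>

lemma divide_coprime_cancel:
  fixes c :: int and m :: nat
  assumes N: "add_subgroup N" and u: "u \<in> N" "(of_int c / of_nat m) *s u \<in> N" and "m > 0" "coprime c (int m)"
  shows "(1 / of_nat m) *s u \<in> N"
proof -
  obtain a b where ab: "a * c + b * int m = 1" using bezout_int[of c "int m"] assms(5) by auto
  have "of_int a *s (of_int c / of_nat m) *s u + of_int b *s u \<in> N"
    using u by (intro add_subgroup_add[OF N] add_subgroup_scale_int[OF N])
  moreover have "of_int a * (of_int c / of_nat m) + of_int b = (1 / of_nat m :: rat)"
  proof -
    have "(of_int (a * c + b * int m) :: rat) = 1" using ab by simp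
    then show ?thesis using \<open>m > 0\<close> by (simp add: field_simps)
  qed
  ultimately show ?thesis by (metis scale_left_distrib scale_scale)
qed

lemma divide_coprime_mult:
  fixes a b :: nat
  assumes N: "add_subgroup N" and u: "(1 / of_nat a) *s u \<in> N" "(1 / of_nat b) *s u \<in> N"
    and "a > 0" "b > 0" "coprime a b"
  shows "(1 / of_nat (a * b)) *s u \<in> N"
proof -
  have "coprime (int a) (int b)" using assms(6) by simp
  then obtain x y where xy: "x * int a + y * int b = 1" using bezout_int[of "int a" "int b"] by auto
  have "of_int x *s (1 / of_nat b) *s u + of_int y *s (1 / of_nat a) *s u \<in> N"
    using u by (intro add_subgroup_add[OF N] add_subgroup_scale_int[OF N])
  moreover have "of_int x * (1 / of_nat b) + of_int y * (1 / of_nat a) = (1 / of_nat (a * b) :: rat)"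
  proof -
    have "(of_int (x * int a + y * int b) :: rat) = 1" using xy by simp
    then show ?thesis using assms(4,5) by (simp add: field_simps)
  qed
  ultimately show ?thesis by (metis scale_left_distrib scale_scale)
qed

lemma divide_dvd:
  fixes d m :: nat
  assumes N: "add_subgroup N" and u: "(1 / of_nat m) *s u \<in> N" and "m > 0" "d dvd m"
  shows "(1 / of_nat d) *s u \<in> N"
proof -
  obtain k where k: "m = d * k" using assms(4) by blast
  have "of_nat k *s (1 / of_nat m) *s u \<in> N" using u by (rule add_subgroup_scale_nat[OF N])
  then show ?thesis using k \<open>m > 0\<close> by simp
qed

text \<open>Coprime denominators combine by Bezout, so divisibility is decided one prime at a time.
  This is the bridge from heights to arbitrary denominators.\<close>

lemma divide_prime_powers:
  fixes m :: nat
  assumes N: "add_subgroup N" and u: "u \<in> N" and "m > 0"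
    and "\<And>p j. Factorial_Ring.prime p \<Longrightarrow> p ^ j dvd m \<Longrightarrow> (1 / of_nat (p ^ j)) *s u \<in> N"
  shows "(1 / of_nat m) *s u \<in> N"
  using assms(3,4)
proof (induction m rule: less_induct)
  case (less m)
  show ?case
  proof (cases "m = 1")
    case True
    then show ?thesis using u by simp
  next
    case False
    then obtain p where p: "Factorial_Ring.prime p" "p dvd m" using prime_factor_nat by blast
    define q where "q = p ^ multiplicity p m"
    obtain k where k: "m = q * k" "\<not> p dvd k"
      unfolding q_def using multiplicity_decompose'[of m p] less.prems(1) p(1)
      by (metis not_gr_zero not_prime_unit)
    have "multiplicity p m > 0" using p less.prems(1) by (simp add: prime_multiplicity_gt_zero_iff)
    then have q: "q > 1" unfolding q_def using p(1) by (intro one_less_power prime_gt_1_nat)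
    have k0: "k > 0" using k less.prems(1) by (cases k) auto
    then have "k < m" using q k(1) by simp
    have "(1 / of_nat k) *s u \<in> N"
    proof (rule less.IH[OF \<open>k < m\<close> k0])
      fix r j assume "Factorial_Ring.prime r" "r ^ j dvd k"
      then show "(1 / of_nat (r ^ j)) *s u \<in> N" using less.prems(2) k(1) by simp
    qed
    moreover have "(1 / of_nat q) *s u \<in> N"
      unfolding q_def using less.prems(2)[OF p(1) multiplicity_dvd] .
    moreover have "coprime q k" unfolding q_def using p(1) k(2) by (simp add: prime_imp_coprime_nat)
    ultimately have "(1 / of_nat (q * k)) *s u \<in> N" using q k0 by (intro divide_coprime_mult[OF N]) auto
    then show ?thesis using k(1) by simp
  qed
qed

lemma divide_multiple_iff:
  fixes c m :: nat
  assumes N: "add_subgroup N" and u: "u \<in> N" and "m > 0" "coprime c m"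
  shows "(1 / of_nat m) *s of_nat c *s u \<in> N \<longleftrightarrow> (1 / of_nat m) *s u \<in> N"
proof
  assume "(1 / of_nat m) *s of_nat c *s u \<in> N"
  then show "(1 / of_nat m) *s u \<in> N"
    using assms divide_coprime_cancel[of N u "int c" m] by simp
next
  assume "(1 / of_nat m) *s u \<in> N"
  then show "(1 / of_nat m) *s of_nat c *s u \<in> N"
    using add_subgroup_scale_nat[OF N, of "(1 / of_nat m) *s u" c] by (simp add: mult.commute)
qed

text \<open>Admissible exponents are closed downwards, so one failing exponent makes the height
  finite: \<open>i\<close> is the predecessor of the least failing exponent, which is positive
  because \<open>u\<close> is in \<open>N\<close>.\<close>

lemma exact_prime_power:
  fixes p :: nat
  assumes N: "add_subgroup N" and u: "u \<in> N" and p: "p > 0" and "\<not> (1 / of_nat (p ^ j)) *s u \<in> N"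
  obtains i where "\<And>l. (1 / of_nat (p ^ l)) *s u \<in> N \<longleftrightarrow> l \<le> i"
proof -
  let ?P = "\<lambda>l. (1 / of_nat (p ^ l)) *s u \<notin> N"
  define i where "i = (LEAST l. ?P l)"
  have P: "?P i" unfolding i_def using assms(4) by (rule LeastI)
  have "\<not> ?P 0" using u by simp
  then have "i > 0" using P by (cases i) auto
  have "(1 / of_nat (p ^ l)) *s u \<in> N \<longleftrightarrow> l \<le> i - 1" for l
  proof
    assume l: "(1 / of_nat (p ^ l)) *s u \<in> N"
    show "l \<le> i - 1"
    proof (rule ccontr)
      assume "\<not> l \<le> i - 1"
      then have "p ^ i dvd p ^ l" by (intro le_imp_power_dvd) simp
      then have "(1 / of_nat (p ^ i)) *s u \<in> N" using p by (intro divide_dvd[OF N l]) auto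
      then show False using P by blast
    qed
  next
    assume "l \<le> i - 1"
    then show "(1 / of_nat (p ^ l)) *s u \<in> N" using \<open>i > 0\<close> not_less_Least[of l ?P] unfolding i_def by auto
  qed
  then show ?thesis by (rule that)
qed

text \<open>The exceptional primes are repaired one by one. If \<open>u\<close> and \<open>w\<close>
  have heights \<open>i\<close> and \<open>j\<close> at \<open>p\<close>, then \<open>w\<close> is
  replaced by \<open>p ^ i / p ^ j\<close> times \<open>w\<close>, which has height \<open>i\<close>
  at \<open>p\<close> and unchanged heights elsewhere. Once no exceptional prime is left,
  \<open>divide_prime_powers\<close> extends the agreement to all denominators.\<close>

lemma equal_characteristics:
  assumes N: "add_subgroup N" and u: "u \<in> N" and "finite P"
    and "w \<in> N" "w \<noteq> 0"
    and "\<And>p j. Factorial_Ring.prime p \<Longrightarrow> p \<notin> P \<Longrightarrow>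
      (1 / of_nat (p ^ j)) *s u \<in> N \<longleftrightarrow> (1 / of_nat (p ^ j)) *s w \<in> N"
    and "\<And>p. p \<in> P \<Longrightarrow> Factorial_Ring.prime p \<and>
      (\<exists>j. (1 / of_nat (p ^ j)) *s u \<notin> N) \<and> (\<exists>j. (1 / of_nat (p ^ j)) *s w \<notin> N)"
  shows "\<exists>v\<in>N. v \<noteq> 0 \<and> v \<in> span {w} \<and>
    (\<forall>m::nat. m > 0 \<longrightarrow> ((1 / of_nat m) *s u \<in> N \<longleftrightarrow> (1 / of_nat m) *s v \<in> N))"
  using assms(3-)
proof (induction P arbitrary: w rule: finite_induct)
  case empty
  have "(1 / of_nat m) *s u \<in> N \<longleftrightarrow> (1 / of_nat m) *s w \<in> N" if m: "m > 0" for m :: nat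
  proof
    assume h: "(1 / of_nat m) *s u \<in> N"
    show "(1 / of_nat m) *s w \<in> N"
    proof (rule divide_prime_powers[OF N empty.prems(1) m])
      fix p j :: nat assume "Factorial_Ring.prime p" "p ^ j dvd m"
      then show "(1 / of_nat (p ^ j)) *s w \<in> N" using divide_dvd[OF N h m] empty.prems(3)[of p j] by blast
    qed
  next
    assume h: "(1 / of_nat m) *s w \<in> N"
    show "(1 / of_nat m) *s u \<in> N"
    proof (rule divide_prime_powers[OF N u m])
      fix p j :: nat assume "Factorial_Ring.prime p" "p ^ j dvd m"
      then show "(1 / of_nat (p ^ j)) *s u \<in> N" using divide_dvd[OF N h m] empty.prems(3)[of p j] by blast
    qed
  qed
  then show ?case using empty.prems(1,2) span_base by (intro bexI[of _ w]) auto
next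
  case (insert p P)
  have p: "Factorial_Ring.prime p" and p0: "p > 0" using insert.prems(4)[of p] by (auto simp: prime_gt_0_nat)
  obtain i where i: "\<And>l. (1 / of_nat (p ^ l)) *s u \<in> N \<longleftrightarrow> l \<le> i"
    using insert.prems(4)[of p] exact_prime_power[OF N u p0] by blast
  obtain j where j: "\<And>l. (1 / of_nat (p ^ l)) *s w \<in> N \<longleftrightarrow> l \<le> j"
    using insert.prems(4)[of p] exact_prime_power[OF N insert.prems(1) p0] by blast
  define w' where "w' = (1 / of_nat (p ^ j)) *s w"
  define v where "v = of_nat (p ^ i) *s w'"
  have w': "w' \<in> N" using j[of j] by (simp add: w'_def)
  have w: "w = of_nat (p ^ j) *s w'" using p0 by (simp add: w'_def)
  have v: "v \<in> N" "v \<noteq> 0"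
    using add_subgroup_scale_nat[OF N w', of "p ^ i"] insert.prems(2) w p0 by (auto simp: v_def)
  have w'span: "w' \<in> span {w}" unfolding w'_def by (intro span_scale span_base) simp
  then have "v \<in> span {w}" unfolding v_def by (rule span_scale)
  have same: "(1 / of_nat (r ^ l)) *s w \<in> N \<longleftrightarrow> (1 / of_nat (r ^ l)) *s v \<in> N"
    if r: "Factorial_Ring.prime r" "r \<noteq> p" for r l
  proof -
    have c: "coprime (p ^ k) (r ^ l)" for k using p r primes_coprime by auto
    have "r ^ l > 0" using r by (simp add: prime_gt_0_nat)
    then show ?thesis unfolding w v_def
      using divide_multiple_iff[OF N w' _ c] by blast
  qed
  have at_p: "(1 / of_nat (p ^ l)) *s v \<in> N \<longleftrightarrow> l \<le> i" for l
  proof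
    assume l: "(1 / of_nat (p ^ l)) *s v \<in> N"
    show "l \<le> i"
    proof (rule ccontr)
      assume "\<not> l \<le> i"
      then obtain k where k: "l = Suc i + k" using le_Suc_ex[of "Suc i" l] by auto
      have "of_nat (p ^ k) *s (1 / of_nat (p ^ l)) *s v \<in> N" using l by (rule add_subgroup_scale_nat[OF N])
      \<comment> \<open>A height of \<open>v\<close> beyond \<open>i\<close> would make
        \<open>w\<close> divisible by \<open>p ^ Suc j\<close>, one more than its exact
        height.\<close>
      moreover have "of_nat (p ^ k) *s (1 / of_nat (p ^ l)) *s v = (1 / of_nat (p ^ Suc j)) *s w"
        using p0 by (simp add: v_def w'_def k power_add field_simps)
      ultimately show False using j[of "Suc j"] by simp
    qed
  next
    assume "l \<le> i"
    then obtain k where k: "i = l + k" using le_Suc_ex by blast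
    have "(1 / of_nat (p ^ l)) *s v = of_nat (p ^ k) *s w'" using p0 by (simp add: v_def k power_add)
    then show "(1 / of_nat (p ^ l)) *s v \<in> N" using add_subgroup_scale_nat[OF N w', of "p ^ k"] by simp
  qed
  have "\<exists>v'\<in>N. v' \<noteq> 0 \<and> v' \<in> span {v} \<and>
    (\<forall>m::nat. m > 0 \<longrightarrow> ((1 / of_nat m) *s u \<in> N \<longleftrightarrow> (1 / of_nat m) *s v' \<in> N))"
  proof (rule insert.IH[OF v])
    fix r l assume r: "Factorial_Ring.prime r" "r \<notin> P"
    show "(1 / of_nat (r ^ l)) *s u \<in> N \<longleftrightarrow> (1 / of_nat (r ^ l)) *s v \<in> N"
    proof (cases "r = p")
      case True
      then show ?thesis using i at_p by simp
    next
      case False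
      then show ?thesis using insert.prems(3)[OF r(1)] r(2) same[OF r(1) False] by simp
    qed
  next
    fix r assume r: "r \<in> P"
    then have "r \<noteq> p" using insert.hyps by blast
    then show "Factorial_Ring.prime r \<and> (\<exists>j. (1 / of_nat (r ^ j)) *s u \<notin> N) \<and> (\<exists>j. (1 / of_nat (r ^ j)) *s v \<notin> N)"
      using insert.prems(4)[of r] r same by auto
  qed
  then obtain v' where v': "v' \<in> N" "v' \<noteq> 0" "v' \<in> span {v}"
    "\<forall>m::nat. m > 0 \<longrightarrow> ((1 / of_nat m) *s u \<in> N \<longleftrightarrow> (1 / of_nat m) *s v' \<in> N)" by blast
  have "v' \<in> span {w}" using v'(3) \<open>v \<in> span {w}\<close> span_minimal[of "{v}" "span {w}"] by auto
  then show ?case using v' by blast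
qed

end

section \<open>Coordinates in torsion-free groups\<close>

context comm_group
begin

section \<open>Integer combinations and rational coordinates\<close>

definition lincomb :: "'a set \<Rightarrow> ('a \<Rightarrow> int) \<Rightarrow> 'a" where
  "lincomb F c = finprod G (\<lambda>s. s [^] c s) F"

lemma lincomb_closed: "F \<subseteq> carrier G \<Longrightarrow> lincomb F c \<in> carrier G"
  unfolding lincomb_def by (intro finprod_closed) auto

lemma lincomb_add:
  "F \<subseteq> carrier G \<Longrightarrow> lincomb F (\<lambda>s. c s + d s) = lincomb F c \<otimes> lincomb F d"
proof -
  assume F: "F \<subseteq> carrier G"
  have "lincomb F (\<lambda>s. c s + d s) = finprod G (\<lambda>s. s [^] c s \<otimes> s [^] d s) F"
    unfolding lincomb_def using F by (intro finprod_cong') (auto simp: int_pow_mult subset_iff)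
  also have "\<dots> = lincomb F c \<otimes> lincomb F d"
    unfolding lincomb_def using F by (intro finprod_multf) auto
  finally show ?thesis .
qed

lemma lincomb_scale:
  "F \<subseteq> carrier G \<Longrightarrow> lincomb F (\<lambda>s. k * c s) = lincomb F c [^] k"
proof (induction F rule: infinite_finite_induct)
  case (insert x F)
  have "lincomb F c \<in> carrier G" using insert by (intro lincomb_closed) auto
  moreover have "(\<lambda>s. s [^] (k * c s)) \<in> F \<rightarrow> carrier G" "(\<lambda>s. s [^] c s) \<in> F \<rightarrow> carrier G"
    using insert by auto
  ultimately show ?case
    using insert by (simp add: lincomb_def int_pow_distrib int_pow_pow mult.commute)
qed (simp_all add: lincomb_def)

lemma lincomb_mono:
  assumes "finite F'" "F \<subseteq> F'" "F' \<subseteq> carrier G" "\<And>s. s \<notin> F \<Longrightarrow> c s = 0"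
  shows "lincomb F' c = lincomb F c"
  unfolding lincomb_def using assms by (intro finprod_mono_neutral_cong_right) auto

lemma independentD:
  assumes "Defs.independent G S" "finite F" "F \<subseteq> S" "lincomb F c = \<one>" "s \<in> F"
  shows "c s = 0"
  using assms unfolding Defs.independent_def lincomb_def by blast

text \<open>Zorn's lemma applies because independence is tested on finite subsets, and a finite
  subset of the union of a non-empty chain lies in one member.\<close>

lemma maximal_independent_exists: "\<exists>S. maximal_independent G S"
proof -
  have "\<exists>S\<in>{S. Defs.independent G S}. \<forall>T\<in>{S. Defs.independent G S}. S \<subseteq> T \<longrightarrow> T = S"
  proof (rule subset_Zorn')
    fix C assume C: "subset.chain {S. Defs.independent G S} C"
    have indC: "Defs.independent G S" if "S \<in> C" for S
      using C that unfolding subset.chain_def by auto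
    show "\<Union>C \<in> {S. Defs.independent G S}"
    proof (cases "C = {}")
      case True
      then show ?thesis by (simp add: Defs.independent_def)
    next
      case False
      show ?thesis
        unfolding Defs.independent_def mem_Collect_eq
      proof (intro conjI allI impI)
        show "\<Union>C \<subseteq> carrier G" using indC by (auto simp: Defs.independent_def)
        fix F and c :: "'a \<Rightarrow> int"
        assume F: "finite F" "F \<subseteq> \<Union>C" "(\<Otimes>s\<in>F. s [^] c s) = \<one>"
        obtain S where "S \<in> C" "F \<subseteq> S" using finite_subset_Union_chain[OF F(1,2) False C] .
        then show "\<forall>s\<in>F. c s = 0" using indC[of S] F(1,3) unfolding Defs.independent_def by blast
      qed
    qed
  qed
  then show ?thesis unfolding maximal_independent_def by auto
qed

text \<open>A witness that \<open>g\<close> has the rational coordinates \<open>c s / n\<close>.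
  Since \<open>c\<close> vanishes off \<open>F\<close>, supports can be enlarged and coordinates
  compared at every \<open>s\<close>.\<close>

definition coordinates :: "'a set \<Rightarrow> 'a \<Rightarrow> nat \<Rightarrow> 'a set \<Rightarrow> ('a \<Rightarrow> int) \<Rightarrow> bool" where
  "coordinates S g n F c \<longleftrightarrow> n > 0 \<and> finite F \<and> F \<subseteq> S \<and> (\<forall>s. s \<notin> F \<longrightarrow> c s = 0) \<and> g [^] n = lincomb F c"

lemma coordinates_exist:
  assumes S: "maximal_independent G S" and g: "g \<in> carrier G"
  obtains n F c where "coordinates S g n F c"
proof (cases "g \<in> S")
  case True
  have "coordinates S g 1 {g} (\<lambda>s. if s = g then 1 else 0)"
    using True g by (auto simp: coordinates_def lincomb_def)
  then show ?thesis by (rule that)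
next
  case False
  have SG: "S \<subseteq> carrier G" and indS: "Defs.independent G S"
    using S by (auto simp: maximal_independent_def Defs.independent_def)
  \<comment> \<open>By maximality there is a relation on \<open>insert g S\<close>; it must involve
    \<open>g\<close>, since otherwise it would be a relation on \<open>S\<close>.\<close>
  have "\<not> Defs.independent G (insert g S)" using S False unfolding maximal_independent_def by blast
  then obtain F and c :: "'a \<Rightarrow> int" where F: "finite F" "F \<subseteq> insert g S" "lincomb F c = \<one>" "\<exists>s\<in>F. c s \<noteq> 0"
    using SG g unfolding Defs.independent_def lincomb_def by blast
  define E where "E = F - {g}"
  have E: "finite E" "E \<subseteq> S" "E \<subseteq> carrier G" "g \<notin> E" using F SG by (auto simp: E_def)
  have gF: "g \<in> F \<and> c g \<noteq> 0"
  proof (rule ccontr)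
    assume not: "\<not> (g \<in> F \<and> c g \<noteq> 0)"
    have "lincomb E c = \<one>"
    proof (cases "g \<in> F")
      case True
      then have "F = insert g E" by (auto simp: E_def)
      moreover have "(\<lambda>s. s [^] c s) \<in> E \<rightarrow> carrier G" using E by auto
      ultimately show ?thesis using F(3) E not True g finprod_closed[of "\<lambda>s. s [^] c s" E] by (simp add: lincomb_def)
    next
      case False
      then show ?thesis using F(3) by (simp add: E_def)
    qed
    then have "\<forall>s\<in>E. c s = 0" using independentD[OF indS E(1,2)] by blast
    then show False using F(4) not by (auto simp: E_def)
  qed
  then have "F = insert g E" by (auto simp: E_def)
  moreover have "(\<lambda>s. s [^] c s) \<in> E \<rightarrow> carrier G" using E by auto
  ultimately have "g [^] c g \<otimes> lincomb E c = \<one>" using F(3) E g by (simp add: lincomb_def)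
  then have gc: "g [^] c g = inv (lincomb E c)"
    using g lincomb_closed[OF E(3)] by (metis int_pow_closed inv_equality)
  \<comment> \<open>The sign makes the exponent of \<open>g\<close> the positive number
    \<open>\<bar>c g\<bar>\<close>; the minus comes from moving the combination to the other
    side.\<close>
  let ?k = "- sgn (c g)"
  have "g [^] (nat \<bar>c g\<bar>) = g [^] (int (nat \<bar>c g\<bar>))" by (simp add: int_pow_int)
  also have "int (nat \<bar>c g\<bar>) = c g * sgn (c g)" by (simp add: sgn_if)
  also have "g [^] (c g * sgn (c g)) = (inv (lincomb E c)) [^] sgn (c g)"
    using g gc int_pow_pow[of g "c g" "sgn (c g)"] by (simp add: mult.commute)
  also have "\<dots> = lincomb E c [^] ?k"
    using lincomb_closed[OF E(3)] by (simp add: int_pow_inv int_pow_neg)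
  also have "\<dots> = lincomb E (\<lambda>s. ?k * (if s \<in> E then c s else 0))"
  proof -
    have "lincomb E c = lincomb E (\<lambda>s. if s \<in> E then c s else 0)"
      unfolding lincomb_def using E by (intro finprod_cong') auto
    then show ?thesis by (simp only: lincomb_scale[OF E(3)])
  qed
  finally have "coordinates S g (nat \<bar>c g\<bar>) E (\<lambda>s. ?k * (if s \<in> E then c s else 0))"
    using gF E by (auto simp: coordinates_def)
  then show ?thesis by (rule that)
qed

lemma coordinates_power:
  assumes g: "g \<in> carrier G" and co: "coordinates S g n F c" and E: "finite E" "F \<subseteq> E" "E \<subseteq> carrier G"
  shows "g [^] (n * m) = lincomb E (\<lambda>s. int m * c s)"
proof -
  have "lincomb E c = g [^] n"
    using co lincomb_mono[OF E, of c] by (auto simp: coordinates_def)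
  then have "g [^] (n * m) = lincomb E c [^] int m"
    using g by (simp add: nat_pow_pow int_pow_int)
  then show ?thesis using lincomb_scale[OF E(3)] by simp
qed

text \<open>Cross-multiplied equality of \<open>c s / n\<close> and \<open>d s / m\<close>. It
  speaks of powers with the common exponent \<open>n * m\<close>, because cancelling that exponent
  requires torsion-freeness.\<close>

lemma coordinates_eq_iff:
  assumes S: "Defs.independent G S" and g: "g \<in> carrier G" "h \<in> carrier G"
    and "coordinates S g n F c" "coordinates S h m F' d"
  shows "g [^] (n * m) = h [^] (n * m) \<longleftrightarrow> (\<forall>s. int m * c s = int n * d s)"
proof -
  have *: "n > 0" "m > 0" "finite F" "finite F'" "F \<subseteq> S" "F' \<subseteq> S" "\<And>s. s \<notin> F \<Longrightarrow> c s = 0"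
    "\<And>s. s \<notin> F' \<Longrightarrow> d s = 0" "g [^] n = lincomb F c" "h [^] m = lincomb F' d"
    using assms(4,5) by (auto simp: coordinates_def)
  let ?E = "F \<union> F'"
  have E: "finite ?E" "?E \<subseteq> S" "?E \<subseteq> carrier G"
    using * S by (auto simp: Defs.independent_def)
  have g': "g [^] (n * m) = lincomb ?E (\<lambda>s. int m * c s)"
    using coordinates_power[OF g(1) assms(4) E(1) _ E(3)] by simp
  have h': "h [^] (n * m) = lincomb ?E (\<lambda>s. int n * d s)"
    using coordinates_power[OF g(2) assms(5) E(1) _ E(3), of n] by (simp add: mult.commute)
  show ?thesis
  proof
    assume eq: "g [^] (n * m) = h [^] (n * m)"
    have "lincomb ?E (\<lambda>s. int m * c s + (- 1) * (int n * d s))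
      = lincomb ?E (\<lambda>s. int m * c s) \<otimes> lincomb ?E (\<lambda>s. int n * d s) [^] (- 1 :: int)"
      by (simp only: lincomb_add[OF E(3)] lincomb_scale[OF E(3)])
    also have "\<dots> = \<one>"
      using eq g' h' lincomb_closed[OF E(3)] by (simp add: int_pow_neg)
    finally have "int m * c s + (- 1) * (int n * d s) = 0" if "s \<in> ?E" for s
      using independentD[OF S E(1,2) _ that, of "\<lambda>s. int m * c s + (- 1) * (int n * d s)"] by simp
    then have "int m * c s = int n * d s" if "s \<in> ?E" for s using that by simp
    moreover have "int m * c s = int n * d s" if "s \<notin> ?E" for s using that *(7,8) by simp
    ultimately show "\<forall>s. int m * c s = int n * d s" by blast
  next
    assume "\<forall>s. int m * c s = int n * d s"
    then show "g [^] (n * m) = h [^] (n * m)" using g' h' by simp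
  qed
qed

lemma coordinates_mult:
  assumes S: "S \<subseteq> carrier G" and g: "g \<in> carrier G" "h \<in> carrier G"
    and "coordinates S g n F c" "coordinates S h m F' d"
  shows "coordinates S (g \<otimes> h) (n * m) (F \<union> F') (\<lambda>s. int m * c s + int n * d s)"
proof -
  have *: "n > 0" "m > 0" "finite F" "finite F'" "F \<subseteq> S" "F' \<subseteq> S" "\<And>s. s \<notin> F \<Longrightarrow> c s = 0"
    "\<And>s. s \<notin> F' \<Longrightarrow> d s = 0" "g [^] n = lincomb F c" "h [^] m = lincomb F' d"
    using assms(4,5) by (auto simp: coordinates_def)
  let ?E = "F \<union> F'"
  have E: "finite ?E" "?E \<subseteq> S" "?E \<subseteq> carrier G" using * S by auto
  have "g [^] (n * m) = lincomb ?E (\<lambda>s. int m * c s)"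
    using coordinates_power[OF g(1) assms(4) E(1) _ E(3)] by simp
  moreover have "h [^] (n * m) = lincomb ?E (\<lambda>s. int n * d s)"
    using coordinates_power[OF g(2) assms(5) E(1) _ E(3), of n] by (simp add: mult.commute)
  ultimately have "(g \<otimes> h) [^] (n * m) = lincomb ?E (\<lambda>s. int m * c s + int n * d s)"
    using g by (simp add: nat_pow_distrib lincomb_add[OF E(3)])
  then show ?thesis using * E unfolding coordinates_def by auto
qed

text \<open>Taking \<open>g = h\<close> in \<open>coordinates_eq_iff\<close> shows that the
  quotients do not depend on the chosen witness, which gives additivity. Equal coordinates give
  equal powers with a positive exponent, hence equal elements.\<close>

lemma torsion_free_embedding:
  assumes tf: "torsion_free G"
  shows "\<exists>e :: 'a \<Rightarrow> 'a \<Rightarrow> rat. (\<forall>x\<in>carrier G. \<forall>y\<in>carrier G. \<forall>s. e (x \<otimes> y) s = e x s + e y s) \<and>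
    inj_on e (carrier G)"
proof -
  obtain S where S: "maximal_independent G S" using maximal_independent_exists ..
  have SG: "S \<subseteq> carrier G" and indS: "Defs.independent G S"
    using S by (auto simp: maximal_independent_def Defs.independent_def)
  have "\<forall>g\<in>carrier G. \<exists>n F c. coordinates S g n F c" using coordinates_exist[OF S] by metis
  then obtain n F c where co: "\<And>g. g \<in> carrier G \<Longrightarrow> coordinates S g (n g) (F g) (c g)" by metis
  define e :: "'a \<Rightarrow> 'a \<Rightarrow> rat" where "e g s = of_int (c g s) / of_nat (n g)" for g s
  have n: "n g > 0" if "g \<in> carrier G" for g using co[OF that] by (simp add: coordinates_def)
  have e: "e g s = of_int (c' s) / of_nat n'" if g: "g \<in> carrier G" "coordinates S g n' F' c'" for g n' F' c' s
  proof -
    have "int n' * c g s = int (n g) * c' s" using coordinates_eq_iff[OF indS g(1) g(1) co[OF g(1)] g(2)] by simp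
    then have "(of_int (int n' * c g s) :: rat) = of_int (int (n g) * c' s)" by simp
    then show ?thesis using n[OF g(1)] g(2) by (simp add: e_def coordinates_def field_simps)
  qed
  have "e (x \<otimes> y) s = e x s + e y s" if xy: "x \<in> carrier G" "y \<in> carrier G" for x y s
    using e[OF m_closed[OF xy] coordinates_mult[OF SG xy co[OF xy(1)] co[OF xy(2)]]] n[OF xy(1)] n[OF xy(2)]
    by (simp add: e_def field_simps)
  moreover have "inj_on e (carrier G)"
  proof (rule inj_onI)
    fix x y assume xy: "x \<in> carrier G" "y \<in> carrier G" and eq: "e x = e y"
    have "int (n y) * c x s = int (n x) * c y s" for s
    proof -
      have "e x s = e y s" using eq by simp
      then have "(of_int (int (n y) * c x s) :: rat) = of_int (int (n x) * c y s)"
        using n[OF xy(1)] n[OF xy(2)] by (simp add: e_def field_simps)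
      then show ?thesis by (simp only: of_int_eq_iff)
    qed
    then have eqp: "x [^] (n x * n y) = y [^] (n x * n y)"
      using coordinates_eq_iff[OF indS xy co[OF xy(1)] co[OF xy(2)]] by simp
    have "(x \<otimes> inv y) [^] (n x * n y) = y [^] (n x * n y) \<otimes> inv (y [^] (n x * n y))"
      using xy eqp by (simp add: nat_pow_distrib nat_pow_inv)
    then have "(x \<otimes> inv y) [^] (n x * n y) = \<one>" using xy by simp
    moreover have "n x * n y > 0" "x \<otimes> inv y \<in> carrier G" using xy n by auto
    ultimately have "x \<otimes> inv y = \<one>" using tf unfolding torsion_free_def by blast
    then show "x = y" using xy by (metis inv_equality inv_inv inv_closed)
  qed
  ultimately show ?thesis by blast
qed

end

section \<open>Transfer along an embedding\<close>

text \<open>Reduces equality of heights, infinite ones included, to divisibility by each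
  \<open>p ^ j\<close>.\<close>

lemma enat_eqI_enat_le:
  assumes "\<And>j. enat j \<le> a \<longleftrightarrow> enat j \<le> b" shows "a = b"
proof -
  have "x \<le> y" if "\<And>j. enat j \<le> x \<Longrightarrow> enat j \<le> y" for x y :: enat
  proof (cases y)
    case (enat n)
    then have "\<not> enat (Suc n) \<le> x" using that[of "Suc n"] by auto
    then show ?thesis using enat that by (cases x) auto
  qed simp
  then show ?thesis using assms by (intro antisym) auto
qed

text \<open>Additivity and injectivity are asked only on the carrier, so one \<open>e\<close> serves
  \<open>G\<close> and all its subgroups, whose images are compared in a single vector
  space.\<close>

locale vector_embedding = comm_group G + rat_vector_space scale
  for G :: "('a, 'g) monoid_scheme" (structure)
    and scale :: "rat \<Rightarrow> 'b::ab_group_add \<Rightarrow> 'b" (infixr \<open>*s\<close> 75) +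
  fixes e :: "'a \<Rightarrow> 'b"
  assumes e_mult: "x \<in> carrier G \<Longrightarrow> y \<in> carrier G \<Longrightarrow> e (x \<otimes> y) = e x + e y"
    and e_inj: "inj_on e (carrier G)"
begin

section \<open>Dictionary between \<open>G\<close> and its image\<close>

lemma e_eq_iff: "x \<in> carrier G \<Longrightarrow> y \<in> carrier G \<Longrightarrow> e x = e y \<longleftrightarrow> x = y"
  using e_inj by (auto simp: inj_on_def)

lemma e_one: "e \<one> = 0"
  using e_mult[of \<one> \<one>] by simp

lemma e_eq_0_iff: "x \<in> carrier G \<Longrightarrow> e x = 0 \<longleftrightarrow> x = \<one>"
  using e_eq_iff[of x \<one>] by (simp add: e_one)

lemma e_inv: "x \<in> carrier G \<Longrightarrow> e (inv x) = - e x"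
  using e_mult[of "inv x" x] by (simp add: e_one eq_neg_iff_add_eq_0)

lemma e_nat_pow: "x \<in> carrier G \<Longrightarrow> e (x [^] (n::nat)) = of_nat n *s e x"
  by (induction n) (auto simp: e_one e_mult scale_left_distrib)

lemma e_int_pow: "x \<in> carrier G \<Longrightarrow> e (x [^] (k::int)) = of_int k *s e x"
  by (cases k) (auto simp: int_pow_int e_nat_pow int_pow_neg_int e_inv simp del: of_nat_Suc Group.nat_pow_Suc nat_pow_Suc)

lemma e_finprod: "f \<in> I \<rightarrow> carrier G \<Longrightarrow> e (finprod G f I) = (\<Sum>i\<in>I. e (f i))"
proof (induction I rule: infinite_finite_induct)
  case (insert i I)
  then have "f \<in> I \<rightarrow> carrier G" "f i \<in> carrier G" by auto
  then show ?case using insert by (simp add: e_mult)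
qed (simp_all add: e_one)

lemma vector_embedding_subgroup:
  assumes "subgroup H G" shows "vector_embedding (G\<lparr>carrier := H\<rparr>) scale e"
proof -
  interpret H: subgroup H G by fact
  have "group (G\<lparr>carrier := H\<rparr>)" by (rule H.subgroup_is_group) unfold_locales
  then have "comm_group (G\<lparr>carrier := H\<rparr>)"
    by (rule group.group_comm_groupI) (auto simp: m_comm)
  then show ?thesis
    by (intro vector_embedding.intro vector_embedding_axioms.intro rat_vector_space_axioms)
      (auto simp: e_mult intro: inj_on_subset[OF e_inj H.subset])
qed

lemma add_subgroup_image:
  assumes "subgroup H G" shows "add_subgroup (e ` H)"
proof -
  interpret H: subgroup H G by fact
  have "e x - e y = e (x \<otimes> inv y)" if "x \<in> H" "y \<in> H" for x y
    using that by (simp add: e_mult e_inv)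
  then have "e x - e y \<in> e ` H" if "x \<in> H" "y \<in> H" for x y
    using that by (metis H.m_closed H.m_inv_closed imageI)
  moreover have "0 \<in> e ` H" using e_one H.one_closed by (metis imageI)
  ultimately show ?thesis by (auto simp: add_subgroup_def)
qed

lemma subgroup_vimage:
  assumes "add_subgroup N" shows "subgroup {x \<in> carrier G. e x \<in> N} G"
  using assms by (intro subgroupI)
    (auto simp: e_inv e_mult add_subgroup_add add_subgroup_uminus e_one add_subgroup_zero intro!: exI[of _ \<one>])

lemma image_vimage: "N \<subseteq> e ` carrier G \<Longrightarrow> e ` {x \<in> carrier G. e x \<in> N} = N"
  by auto

lemma image_mem_iff: "A \<subseteq> carrier G \<Longrightarrow> x \<in> carrier G \<Longrightarrow> e x \<in> e ` A \<longleftrightarrow> x \<in> A"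
  using e_inj by (meson inj_on_image_mem_iff)

text \<open>A rational relation between the images becomes an integer relation in \<open>G\<close>
  after clearing denominators; injectivity of \<open>e\<close> keeps indices and vectors in
  bijection.\<close>

lemma independent_iff: "Defs.independent G S \<longleftrightarrow> S \<subseteq> carrier G \<and> \<not> dependent (e ` S)"
proof (cases "S \<subseteq> carrier G")
  case True
  have comb: "e (\<Otimes>s\<in>F. s [^] c s) = (\<Sum>s\<in>F. of_int (c s) *s e s)" if F: "F \<subseteq> S" for F and c :: "'a \<Rightarrow> int"
  proof -
    have "(\<lambda>s. s [^] c s) \<in> F \<rightarrow> carrier G" using True F by auto
    then show ?thesis using True F by (subst e_finprod) (auto intro!: sum.cong simp: e_int_pow subset_iff)
  qed
  have closed: "(\<Otimes>s\<in>F. s [^] c s) \<in> carrier G" if F: "F \<subseteq> S" for F and c :: "'a \<Rightarrow> int"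
    using True F by (intro finprod_closed) auto
  have inj: "inj_on e F" if "F \<subseteq> S" for F using inj_on_subset[OF e_inj] True that by blast
  show ?thesis
  proof
    assume ind: "Defs.independent G S"
    have "\<not> dependent (e ` S)"
    proof
      assume "dependent (e ` S)"
      then obtain t u v where t: "finite t" "t \<subseteq> e ` S" "(\<Sum>v\<in>t. u v *s v) = 0" "v \<in> t" "u v \<noteq> 0"
        unfolding dependent_explicit by blast
      obtain F where F: "F \<subseteq> S" "finite F" "t = e ` F" using finite_subset_image[OF t(1,2)] by blast
      obtain N :: nat and c where N: "N > 0" "\<And>s. s \<in> F \<Longrightarrow> of_nat N * u (e s) = of_int (c s)"
        using common_denominator[OF F(2), of "\<lambda>s. u (e s)"] by blast
      have "e (\<Otimes>s\<in>F. s [^] c s) = (\<Sum>s\<in>F. of_nat N *s u (e s) *s e s)"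
        unfolding comb[OF F(1)] by (intro sum.cong) (simp_all add: N(2)[symmetric])
      also have "\<dots> = of_nat N *s (\<Sum>v\<in>t. u v *s v)"
        unfolding F(3) sum.reindex[OF inj[OF F(1)]] by (simp add: scale_sum_right)
      finally have "(\<Otimes>s\<in>F. s [^] c s) = \<one>" using t(3) e_eq_0_iff[OF closed[OF F(1)]] by simp
      then have "\<forall>s\<in>F. c s = 0" using ind F(1,2) unfolding Defs.independent_def by blast
      moreover obtain s where "s \<in> F" "v = e s" using t(4) F(3) by blast
      ultimately show False using N t(5) by fastforce
    qed
    then show "S \<subseteq> carrier G \<and> \<not> dependent (e ` S)" using True by blast
  next
    assume "S \<subseteq> carrier G \<and> \<not> dependent (e ` S)"
    then have nd: "\<not> dependent (e ` S)" by blast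
    show "Defs.independent G S"
      unfolding Defs.independent_def
    proof (intro conjI allI impI ballI)
      show "S \<subseteq> carrier G" by fact
      fix F and c :: "'a \<Rightarrow> int" and s
      assume F: "finite F" "F \<subseteq> S" "(\<Otimes>s\<in>F. s [^] c s) = \<one>" "s \<in> F"
      define u where "u v = (of_int (c (inv_into F e v)) :: rat)" for v
      have ue: "u (e s) = of_int (c s)" if "s \<in> F" for s
        using that inj[OF F(2)] by (simp add: u_def)
      have "(\<Sum>v\<in>e ` F. u v *s v) = (\<Sum>s\<in>F. of_int (c s) *s e s)"
        unfolding sum.reindex[OF inj[OF F(2)]] by (intro sum.cong) (simp_all add: ue)
      also have "\<dots> = 0" using comb[OF F(2), of c] F(3) e_one by simp
      finally have "u (e s) = 0"
        using nd F unfolding dependent_explicit by (meson finite_imageI image_eqI image_mono)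
      then show "c s = 0" using ue[OF F(4)] by simp
    qed
  qed
qed (simp add: Defs.independent_def)

lemma maximal_independent_iff:
  "maximal_independent G S \<longleftrightarrow> S \<subseteq> carrier G \<and> \<not> dependent (e ` S) \<and> e ` carrier G \<subseteq> span (e ` S)"
proof
  assume S: "maximal_independent G S"
  then have ind: "S \<subseteq> carrier G" "\<not> dependent (e ` S)"
    using independent_iff by (auto simp: maximal_independent_def)
  have "e g \<in> span (e ` S)" if g: "g \<in> carrier G" for g
  proof (rule ccontr)
    assume ng: "e g \<notin> span (e ` S)"
    then have "\<not> dependent (e ` insert g S)" using ind independent_insertI by simp
    then have "Defs.independent G (insert g S)" using independent_iff ind g by blast
    then have "g \<in> S" using S unfolding maximal_independent_def by blast
    then show False using ng span_base by blast
  qed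
  then show "S \<subseteq> carrier G \<and> \<not> dependent (e ` S) \<and> e ` carrier G \<subseteq> span (e ` S)" using ind by blast
next
  assume S: "S \<subseteq> carrier G \<and> \<not> dependent (e ` S) \<and> e ` carrier G \<subseteq> span (e ` S)"
  have "T = S" if T: "Defs.independent G T" "S \<subseteq> T" for T
  proof (rule ccontr)
    assume "T \<noteq> S"
    then obtain t where t: "t \<in> T" "t \<notin> S" using T by blast
    have TG: "T \<subseteq> carrier G" "\<not> dependent (e ` T)" using T independent_iff by auto
    have "e t \<notin> e ` S" using t TG S image_mem_iff[of S t] by blast
    then have "e ` S \<subseteq> e ` T - {e t}" using T(2) by blast
    then have "e t \<in> span (e ` T - {e t})" using span_mono S t(1) TG(1) by blast
    then show False using TG(2) t(1) unfolding dependent_def by blast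
  qed
  then show "maximal_independent G S" using S independent_iff unfolding maximal_independent_def by blast
qed

lemma finite_rank_iff: "finite_rank G \<longleftrightarrow> (\<exists>B. finite B \<and> e ` carrier G \<subseteq> span B)"
proof
  assume "finite_rank G"
  then show "\<exists>B. finite B \<and> e ` carrier G \<subseteq> span B"
    unfolding finite_rank_def maximal_independent_iff by blast
next
  assume "\<exists>B. finite B \<and> e ` carrier G \<subseteq> span B"
  then obtain B where B: "finite B" "e ` carrier G \<subseteq> span B" by blast
  obtain Z where Z: "Z \<subseteq> e ` carrier G" "\<not> dependent Z" "e ` carrier G \<subseteq> span Z"
    by (rule maximal_independent_subset[of "e ` carrier G"])
  obtain S where S: "S \<subseteq> carrier G" "Z = e ` S" using Z(1) by (auto simp: subset_image_iff)
  have "finite (e ` S)" using independent_span_bound[OF B(1) Z(2)] Z(1) B(2) S(2) by auto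
  then have "finite S" using finite_imageD inj_on_subset[OF e_inj S(1)] by blast
  then show "finite_rank G" unfolding finite_rank_def maximal_independent_iff using S Z by blast
qed

lemma rank_one_iff: "rank_one G \<longleftrightarrow> (\<exists>x\<in>carrier G. x \<noteq> \<one> \<and> e ` carrier G \<subseteq> span {e x})"
proof
  assume "rank_one G"
  then obtain x where "maximal_independent G {x}" unfolding rank_one_def by (metis card_1_singletonE)
  then show "\<exists>x\<in>carrier G. x \<noteq> \<one> \<and> e ` carrier G \<subseteq> span {e x}"
    unfolding maximal_independent_iff using e_one by (intro bexI[of _ x]) auto
next
  assume "\<exists>x\<in>carrier G. x \<noteq> \<one> \<and> e ` carrier G \<subseteq> span {e x}"
  then obtain x where "x \<in> carrier G" "x \<noteq> \<one>" "e ` carrier G \<subseteq> span {e x}" by blast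
  then have "maximal_independent G {x}" unfolding maximal_independent_iff using e_eq_0_iff by auto
  then show "rank_one G" unfolding rank_one_def by (intro exI[of _ "{x}"]) simp
qed

lemma root_iff:
  assumes "x \<in> carrier G" "n > 0"
  shows "(\<exists>y\<in>carrier G. y [^] (n::nat) = x) \<longleftrightarrow> (1 / of_nat n) *s e x \<in> e ` carrier G"
proof
  assume "\<exists>y\<in>carrier G. y [^] n = x"
  then obtain y where y: "y \<in> carrier G" "x = y [^] n" by blast
  then have "(1 / of_nat n) *s e x = e y" using assms(2) by (simp add: e_nat_pow)
  then show "(1 / of_nat n) *s e x \<in> e ` carrier G" using y(1) by blast
next
  assume "(1 / of_nat n) *s e x \<in> e ` carrier G"
  then obtain y where y: "y \<in> carrier G" "(1 / of_nat n) *s e x = e y" by blast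
  have "e (y [^] n) = e x" using y assms(2) by (simp add: e_nat_pow y(2)[symmetric])
  then have "y [^] n = x" using y(1) assms(1) e_eq_iff by simp
  then show "\<exists>y\<in>carrier G. y [^] n = x" using y(1) by blast
qed

lemma divisible_iff: "divisible G \<longleftrightarrow> subspace (e ` carrier G)"
proof
  have M: "add_subgroup (e ` carrier G)" by (rule add_subgroup_image[OF subgroup_self])
  assume "divisible G"
  then have "(1 / of_nat n) *s e x \<in> e ` carrier G" if "x \<in> carrier G" "n > 0" for x n
    using that root_iff[OF that] unfolding divisible_def by blast
  then have "e x \<in> divisible_part (e ` carrier G)" if "x \<in> carrier G" for x
    using that by (intro divisible_part_nat[OF M]) auto
  then have "divisible_part (e ` carrier G) = e ` carrier G" using divisible_part_subset by blast
  then show "subspace (e ` carrier G)" using subspace_divisible_part[OF M] by simp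
next
  assume "subspace (e ` carrier G)"
  then have "(1 / of_nat n) *s e x \<in> e ` carrier G" if "x \<in> carrier G" for x and n :: nat
    using that by (intro subspace_scale) auto
  then show "divisible G" unfolding divisible_def using root_iff by simp
qed

lemma direct_sum_iff:
  assumes "subgroup A G" "subgroup B G"
  shows "direct_sum (e ` carrier G) (e ` A) (e ` B) \<longleftrightarrow> A \<inter> B = {\<one>} \<and> A <#> B = carrier G"
proof -
  have sub: "A \<subseteq> carrier G" "B \<subseteq> carrier G" using assms subgroup.subset by blast+
  have "e ` A \<inter> e ` B = e ` (A \<inter> B)" using inj_on_image_Int[OF e_inj sub] by simp
  then have "e ` A \<inter> e ` B = {0} \<longleftrightarrow> e ` (A \<inter> B) = e ` {\<one>}" by (simp add: e_one)
  also have "\<dots> \<longleftrightarrow> A \<inter> B = {\<one>}" using sub by (intro inj_on_image_eq_iff[OF e_inj]) auto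
  finally have 1: "e ` A \<inter> e ` B = {0} \<longleftrightarrow> A \<inter> B = {\<one>}" .
  have AB: "A <#> B \<subseteq> carrier G" using sub by (auto simp: set_mult_def)
  have "{a + c | a c. a \<in> e ` A \<and> c \<in> e ` B} = e ` (A <#> B)"
  proof (intro equalityI subsetI)
    fix x assume "x \<in> {a + c | a c. a \<in> e ` A \<and> c \<in> e ` B}"
    then obtain a b where "a \<in> A" "b \<in> B" "x = e a + e b" by blast
    then show "x \<in> e ` (A <#> B)" using sub
      by (intro image_eqI[of _ _ "a \<otimes> b"]) (auto simp: e_mult set_mult_def subset_iff)
  next
    fix x assume "x \<in> e ` (A <#> B)"
    then obtain a b where "a \<in> A" "b \<in> B" "x = e (a \<otimes> b)" by (auto simp: set_mult_def)
    then show "x \<in> {a + c | a c. a \<in> e ` A \<and> c \<in> e ` B}" using sub e_mult by blast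
  qed
  then have "e ` carrier G = {a + c | a c. a \<in> e ` A \<and> c \<in> e ` B} \<longleftrightarrow> A <#> B = carrier G"
    using inj_on_image_eq_iff[OF e_inj subset_refl AB] by auto
  then show ?thesis using 1 assms by (simp add: direct_sum_def add_subgroup_image)
qed

lemma coset_eq_iff:
  assumes H: "subgroup H G" and ab: "a \<in> carrier G" "b \<in> carrier G"
  shows "H #> a = H #> b \<longleftrightarrow> e a - e b \<in> e ` H"
proof -
  interpret H: subgroup H G by fact
  have "e a - e b \<in> e ` H \<longleftrightarrow> a \<otimes> inv b \<in> H"
    using ab image_mem_iff[OF H.subset, of "a \<otimes> inv b"] by (simp add: e_mult e_inv)
  also have "\<dots> \<longleftrightarrow> a \<in> H #> b" using H.rcos_module[OF is_group ab(2,1)] by simp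
  also have "\<dots> \<longleftrightarrow> H #> a = H #> b"
    using repr_independence[OF _ ab(2) H] repr_independenceD[OF H ab(1)] by metis
  finally show ?thesis by simp
qed

lemma embeds_mod_iff:
  assumes H: "subgroup H G"
  shows "(\<exists>f. f \<in> hom G (G Mod H) \<and> inj_on f (carrier G)) \<longleftrightarrow> embeds_mod (e ` carrier G) (e ` H)"
proof -
  interpret H: normal H G by (rule subgroup_imp_normal[OF H])
  have HH: "H #> \<one> = H" by (simp add: coset_mult_one H.subset)
  show ?thesis
  proof
    assume "\<exists>f. f \<in> hom G (G Mod H) \<and> inj_on f (carrier G)"
    then obtain f where f: "f \<in> hom G (G Mod H)" "inj_on f (carrier G)" by blast
    have "\<forall>x\<in>carrier G. \<exists>r. r \<in> carrier G \<and> f x = H #> r"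
      using hom_carrier[OF f(1)] by (auto simp: FactGroup_def RCOSETS_def)
    then obtain r where r: "\<And>x. x \<in> carrier G \<Longrightarrow> r x \<in> carrier G" "\<And>x. x \<in> carrier G \<Longrightarrow> f x = H #> r x"
      by metis
    define g where "g v = e (r (inv_into (carrier G) e v))" for v
    have g: "g (e x) = e (r x)" if "x \<in> carrier G" for x
      using that e_inj by (simp add: g_def)
    have f1: "f \<one> = H" using hom_one[OF f(1)] H.factorgroup_is_group is_group by (simp add: FactGroup_def)
    have add: "g (e x + e y) - g (e x) - g (e y) \<in> e ` H" if xy: "x \<in> carrier G" "y \<in> carrier G" for x y
    proof -
      have "H #> r (x \<otimes> y) = f x <#> f y"
        using hom_mult[OF f(1) xy] r(2)[of "x \<otimes> y"] xy by (simp add: FactGroup_def)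
      also have "\<dots> = H #> (r x \<otimes> r y)" using r xy by (simp add: H.rcos_sum)
      finally have "e (r (x \<otimes> y)) - e (r x \<otimes> r y) \<in> e ` H"
        using coset_eq_iff[OF H] r(1) xy by simp
      then show ?thesis using g[of "x \<otimes> y"] g[OF xy(1)] g[OF xy(2)] xy r(1) by (simp add: e_mult diff_diff_eq)
    qed
    have inj: "x = \<one>" if x: "x \<in> carrier G" "g (e x) \<in> e ` H" for x
    proof -
      have "e (r x) - e \<one> \<in> e ` H" using x g[OF x(1)] by (simp add: e_one)
      then have "f x = f \<one>" using coset_eq_iff[OF H r(1)[OF x(1)], of \<one>] r(2)[OF x(1)] HH f1 by simp
      then show ?thesis using inj_onD[OF f(2)] x(1) by simp
    qed
    show "embeds_mod (e ` carrier G) (e ` H)"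
      unfolding embeds_mod_def
      by (rule exI[of _ g]) (use add inj e_one g r(1) in auto)
  next
    assume emb: "embeds_mod (e ` carrier G) (e ` H)"
    obtain g where F: "(\<forall>x\<in>e ` carrier G. g x \<in> e ` carrier G) \<and>
      (\<forall>x\<in>e ` carrier G. \<forall>y\<in>e ` carrier G. g (x + y) - g x - g y \<in> e ` H) \<and>
      (\<forall>x\<in>e ` carrier G. g x \<in> e ` H \<longrightarrow> x = 0)"
      using emb unfolding embeds_mod_def by (rule exE)
    have "\<forall>x\<in>carrier G. \<exists>r. r \<in> carrier G \<and> g (e x) = e r" using F by blast
    then obtain r where r: "\<And>x. x \<in> carrier G \<Longrightarrow> r x \<in> carrier G" "\<And>x. x \<in> carrier G \<Longrightarrow> g (e x) = e (r x)"
      by metis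
    define f where "f x = H #> r x" for x
    have eq: "H #> r (x \<otimes> y) = H #> (r x \<otimes> r y)" if xy: "x \<in> carrier G" "y \<in> carrier G" for x y
    proof -
      have "g (e x + e y) - g (e x) - g (e y) \<in> e ` H" using F xy by blast
      then have "e (r (x \<otimes> y)) - e (r x \<otimes> r y) \<in> e ` H"
        using r(2)[of "x \<otimes> y"] r xy by (simp add: e_mult diff_diff_eq)
      then show ?thesis using coset_eq_iff[OF H] r(1) xy by simp
    qed
    have "f \<in> hom G (G Mod H)"
      using r(1) eq by (auto simp: hom_def FactGroup_def f_def H.rcos_sum intro!: rcosetsI H.subset)
    moreover have "inj_on f (carrier G)"
    proof (rule inj_onI)
      fix x y assume xy: "x \<in> carrier G" "y \<in> carrier G" "f x = f y"
      \<comment> \<open>The representatives are additive only modulo \<open>H\<close>, so equal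
        cosets are first turned into a quotient \<open>?z\<close> whose image lies in
        \<open>H\<close>; then the kernel condition applies.\<close>
      let ?z = "x \<otimes> inv y"
      have z: "?z \<in> carrier G" "?z \<otimes> y = x" using xy by (simp_all add: m_assoc)
      have 1: "e (r x) - e (r y) \<in> e ` H" using xy coset_eq_iff[OF H] r(1) by (simp add: f_def)
      have "H #> r x = H #> (r ?z \<otimes> r y)" using eq[OF z(1) xy(2)] z(2) by simp
      then have 2: "e (r x) - e (r ?z \<otimes> r y) \<in> e ` H" using coset_eq_iff[OF H] r(1) xy z by simp
      have "e (r ?z) = (e (r x) - e (r y)) - (e (r x) - e (r ?z \<otimes> r y))"
        using r(1) xy z by (simp add: e_mult)
      then have "g (e ?z) \<in> e ` H" using add_subgroup_diff[OF add_subgroup_image[OF H] 1 2] r(2)[OF z(1)] by simp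
      then have "e ?z = 0" using F z(1) by blast
      then have "?z = \<one>" using e_eq_0_iff[OF z(1)] by simp
      then show "x = y" using z xy by simp
    qed
    ultimately show "\<exists>f. f \<in> hom G (G Mod H) \<and> inj_on f (carrier G)" by blast
  qed
qed

text \<open>For one inclusion, essentiality is tested on the cyclic group of a single
  \<open>x\<close> in \<open>A\<close>, which yields a non-zero multiple of \<open>x\<close> in
  \<open>H\<close>. The other is the purity of a summand.\<close>

lemma essential_in_image_eq:
  assumes H: "subgroup H G" and A: "direct_summand G A" and ess: "essential_in G H A"
  shows "e ` A = e ` carrier G \<inter> span (e ` H)"
proof -
  obtain B where B: "subgroup A G" "subgroup B G" "A \<inter> B = {\<one>}" "A <#> B = carrier G"
    using A unfolding direct_summand_def by blast
  interpret A: subgroup A G by (rule B(1))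
  have ds: "direct_sum (e ` carrier G) (e ` A) (e ` B)" using direct_sum_iff[OF B(1,2)] B by simp
  have HA: "H \<subseteq> A" using ess by (simp add: essential_in_def)
  have "e x \<in> span (e ` H)" if x: "x \<in> A" for x
  proof (cases "x = \<one>")
    case True
    then show ?thesis by (simp add: e_one span_zero)
  next
    case False
    let ?S = "generate G {x}"
    have xG: "x \<in> carrier G" using x by simp
    have S: "subgroup ?S G" using generate_is_subgroup[of "{x}"] xG by simp
    have "?S \<subseteq> A" using generate_subgroup_incl[of "{x}" A] x B(1) by simp
    moreover have "?S \<noteq> {\<one>}" using False generate.incl[of x "{x}" G] by auto
    ultimately have "H \<inter> ?S \<noteq> {\<one>}" using ess S unfolding essential_in_def by blast
    moreover have "\<one> \<in> H \<inter> ?S" using H S subgroup.one_closed by blast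
    ultimately obtain h where h: "h \<in> H" "h \<in> ?S" "h \<noteq> \<one>" by blast
    obtain k :: int where k: "h = x [^] k" using h(2) generate_pow[OF xG] by auto
    have "k \<noteq> 0" using h(3) k by auto
    moreover have "of_int k *s e x \<in> span (e ` H)" using h(1) k xG e_int_pow span_base by (metis imageI)
    ultimately show ?thesis using in_subspace_scale_iff[of "span (e ` H)" "of_int k" "e x"] by simp
  qed
  moreover have "v \<in> e ` A" if v: "v \<in> e ` carrier G" "v \<in> span (e ` H)" for v
  proof -
    have "v \<in> span (e ` A)" using v(2) span_mono[OF image_mono[OF HA]] by blast
    then show ?thesis using direct_sum_span_components(1)[OF ds _ span_zero, of v] v(1) by simp
  qed
  ultimately show ?thesis using A.subset by blast
qed

lemma semi_generalized_Bassian_iff: "semi_generalized_Bassian G \<longleftrightarrow> pure_Bassian (e ` carrier G)"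
proof
  let ?M = "e ` carrier G"
  assume sgb: "semi_generalized_Bassian G"
  show "pure_Bassian ?M"
    unfolding pure_Bassian_def
  proof (intro allI impI)
    fix K assume K: "add_subgroup K" "K \<subseteq> ?M" "embeds_mod ?M K"
    define H where "H = {x \<in> carrier G. e x \<in> K}"
    have H: "subgroup H G" "e ` H = K" unfolding H_def by (rule subgroup_vimage[OF K(1)], rule image_vimage[OF K(2)])
    then obtain A where A: "direct_summand G A" "essential_in G H A"
      using sgb K(3) embeds_mod_iff[OF H(1)] unfolding semi_generalized_Bassian_def by metis
    obtain B where B: "subgroup A G" "subgroup B G" "A \<inter> B = {\<one>}" "A <#> B = carrier G"
      using A(1) unfolding direct_summand_def by blast
    have "direct_sum ?M (e ` A) (e ` B)" using direct_sum_iff[OF B(1,2)] B by simp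
    then show "\<exists>C. direct_sum ?M (?M \<inter> span K) C"
      using essential_in_image_eq[OF H(1) A] H(2) by auto
  qed
next
  let ?M = "e ` carrier G"
  assume pb: "pure_Bassian ?M"
  show "semi_generalized_Bassian G"
    unfolding semi_generalized_Bassian_def
  proof (intro allI impI)
    fix H assume H: "subgroup H G" and emb: "\<exists>f. f \<in> hom G (G Mod H) \<and> inj_on f (carrier G)"
    have HG: "H \<subseteq> carrier G" using H subgroup.subset by blast
    obtain C where C: "direct_sum ?M (?M \<inter> span (e ` H)) C"
      using pb emb embeds_mod_iff[OF H] add_subgroup_image[OF H] HG unfolding pure_Bassian_def by blast
    define A where "A = {x \<in> carrier G. e x \<in> ?M \<inter> span (e ` H)}"
    define B where "B = {x \<in> carrier G. e x \<in> C}"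
    have AB: "subgroup A G" "subgroup B G" unfolding A_def B_def
      by (rule subgroup_vimage[OF direct_sum_subgroups(1)[OF C]], rule subgroup_vimage[OF direct_sum_subgroups(2)[OF C]])
    have "e ` A = ?M \<inter> span (e ` H)" "e ` B = C" unfolding A_def B_def
      using direct_sum_right[OF C] by (auto intro!: image_vimage)
    then have "A \<inter> B = {\<one>} \<and> A <#> B = carrier G" using direct_sum_iff[OF AB] C by simp
    then have "direct_summand G A" unfolding direct_summand_def using AB by blast
    moreover have "essential_in G H A"
      unfolding essential_in_def
    proof (intro conjI allI impI)
      show "H \<subseteq> A" unfolding A_def using HG span_base by blast
      fix S assume S: "subgroup S G" "S \<subseteq> A" "S \<noteq> {\<one>}"
      obtain x where x: "x \<in> S" "x \<noteq> \<one>" using S subgroup.one_closed by blast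
      then have xA: "x \<in> carrier G" "e x \<in> span (e ` H)" using S(2) by (auto simp: A_def)
      \<comment> \<open>Every element of the pure hull has a positive power in \<open>H\<close>; by
        injectivity of \<open>e\<close> it is non-trivial, and it lies in \<open>S\<close>.\<close>
      obtain n :: nat where n: "n > 0" "of_nat n *s e x \<in> e ` H"
        using span_add_subgroup_multiple[OF add_subgroup_image[OF H] xA(2)] .
      have "e (x [^] n) \<in> e ` H" using n(2) xA(1) by (simp add: e_nat_pow)
      then have "x [^] n \<in> H" using image_mem_iff[OF HG] xA(1) by simp
      moreover have "x [^] n \<in> S" using subgroup_int_pow_closed[OF S(1) x(1), of "int n"] by (simp add: int_pow_int)
      moreover have "x [^] n \<noteq> \<one>"
        using n(1) x(2) xA(1) e_eq_0_iff[of x] e_eq_0_iff[of "x [^] n"] by (simp add: e_nat_pow)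
      ultimately show "H \<inter> S \<noteq> {\<one>}" by blast
    qed
    ultimately show "\<exists>A. direct_summand G A \<and> essential_in G H A" by blast
  qed
qed

section \<open>Heights and types\<close>

lemma carrier_image: "add_subgroup (e ` carrier G)"
  by (rule add_subgroup_image[OF subgroup_self])

text \<open>The exponents under the supremum form an initial segment, so if \<open>j\<close> fails
  the supremum is bounded by some \<open>i\<close> below \<open>j\<close>.\<close>

lemma height_ge_iff:
  assumes x: "x \<in> carrier G" and p: "p > 0"
  shows "enat j \<le> height G p x \<longleftrightarrow> (1 / of_nat (p ^ j)) *s e x \<in> e ` carrier G"
proof -
  have h: "height G p x = Sup {enat k | k. (1 / of_nat (p ^ k)) *s e x \<in> e ` carrier G}"
    unfolding height_def using root_iff[OF x, of "p ^ _"] p by simp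
  show ?thesis
  proof
    assume j: "enat j \<le> height G p x"
    show "(1 / of_nat (p ^ j)) *s e x \<in> e ` carrier G"
    proof (rule ccontr)
      assume "(1 / of_nat (p ^ j)) *s e x \<notin> e ` carrier G"
      then obtain i where i: "\<And>l. (1 / of_nat (p ^ l)) *s e x \<in> e ` carrier G \<longleftrightarrow> l \<le> i"
        using exact_prime_power[OF carrier_image imageI[OF x] p] by blast
      have "height G p x \<le> enat i" unfolding h using i by (intro Sup_least) auto
      then have "j \<le> i" using j order_trans by fastforce
      then show False using i \<open>(1 / of_nat (p ^ j)) *s e x \<notin> e ` carrier G\<close> by simp
    qed
  next
    assume "(1 / of_nat (p ^ j)) *s e x \<in> e ` carrier G"
    then show "enat j \<le> height G p x" unfolding h by (intro Sup_upper) auto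
  qed
qed

text \<open>The factors \<open>k\<close> and \<open>l\<close> for the two orders shift the height at
  \<open>p\<close> by at most the multiplicity of \<open>p\<close> in them. So heights agree at
  primes not dividing \<open>k * l\<close>, and at every prime they are both finite or both
  infinite.\<close>

lemma homogeneousI:
  assumes "\<And>y z. y \<in> e ` carrier G \<Longrightarrow> z \<in> e ` carrier G \<Longrightarrow> y \<noteq> 0 \<Longrightarrow> \<exists>k::nat. k > 0 \<and>
    (\<forall>m::nat. m > 0 \<longrightarrow> (1 / of_nat m) *s y \<in> e ` carrier G \<longrightarrow> (of_nat k / of_nat m) *s z \<in> e ` carrier G)"
  shows "homogeneous G"
  unfolding homogeneous_def
proof (intro ballI impI)
  let ?M = "e ` carrier G"
  fix x y assume xy: "x \<in> carrier G" "y \<in> carrier G" "x \<noteq> \<one>" "y \<noteq> \<one>"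
  define D where "D p j x \<longleftrightarrow> (1 / of_nat (p ^ j)) *s e x \<in> ?M" for p j :: nat and x
  \<comment> \<open>The power of \<open>p\<close> in \<open>k\<close> is traded against the
    exponent; the remaining factor \<open>c\<close> of \<open>k\<close> is prime to \<open>p\<close>
    and cancels.\<close>
  have shift: "\<exists>k::nat. k > 0 \<and> (\<forall>p j. Factorial_Ring.prime p \<longrightarrow> D p (j + multiplicity p k) x \<longrightarrow> D p j y)"
    if xy: "x \<in> carrier G" "y \<in> carrier G" "x \<noteq> \<one>" for x y
  proof -
    have "e x \<noteq> 0" using xy e_eq_0_iff by simp
    then obtain k :: nat where k: "k > 0"
      "\<And>m::nat. m > 0 \<Longrightarrow> (1 / of_nat m) *s e x \<in> ?M \<Longrightarrow> (of_nat k / of_nat m) *s e y \<in> ?M"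
      using assms[OF imageI[OF xy(1)] imageI[OF xy(2)]] by blast
    have "D p j y" if p: "Factorial_Ring.prime p" "D p (j + multiplicity p k) x" for p j
    proof -
      obtain c where c: "k = p ^ multiplicity p k * c" "\<not> p dvd c"
        using multiplicity_decompose'[of k p] k(1) p(1) by (metis not_gr_zero not_prime_unit)
      have p0: "p > 0" using p(1) by (simp add: prime_gt_0_nat)
      have "(of_nat k / of_nat (p ^ (j + multiplicity p k))) *s e y \<in> ?M"
        using p0 by (intro k(2) p(2)[unfolded D_def]) simp
      moreover have "(of_nat k / of_nat (p ^ (j + multiplicity p k)) :: rat) = of_int (int c) / of_nat (p ^ j)"
      proof -
        have "(of_nat k :: rat) = of_nat (p ^ multiplicity p k) * of_nat c" using c(1) by (metis of_nat_mult)
        then show ?thesis using p0 by (simp add: power_add)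
      qed
      ultimately have "(of_int (int c) / of_nat (p ^ j)) *s e y \<in> ?M" by simp
      moreover have "coprime c (p ^ j)" using p(1) c(2) prime_imp_coprime_nat coprime_commute by auto
      then have "coprime (int c) (int (p ^ j))" by (simp only: coprime_int_iff)
      ultimately show ?thesis unfolding D_def
        using xy(2) p0 by (intro divide_coprime_cancel[OF carrier_image, of _ "int c"]) auto
    qed
    then show ?thesis using k(1) by blast
  qed
  obtain k :: nat where k: "k > 0" "\<And>p j. Factorial_Ring.prime p \<Longrightarrow> D p (j + multiplicity p k) x \<Longrightarrow> D p j y"
    using shift[OF xy(1,2,3)] by blast
  obtain l :: nat where l: "l > 0" "\<And>p j. Factorial_Ring.prime p \<Longrightarrow> D p (j + multiplicity p l) y \<Longrightarrow> D p j x"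
    using shift[OF xy(2,1,4)] by blast
  have h: "enat j \<le> height G p x \<longleftrightarrow> D p j x" "enat j \<le> height G p y \<longleftrightarrow> D p j y"
    if "Factorial_Ring.prime p" for p j
    unfolding D_def using height_ge_iff xy that by (auto simp: prime_gt_0_nat)
  have eq: "height G p x = height G p y" if p: "Factorial_Ring.prime p" "\<not> p dvd k * l" for p
  proof (rule enat_eqI_enat_le)
    have "multiplicity p k = 0" "multiplicity p l = 0" using p(2) by (auto intro: not_dvd_imp_multiplicity_0)
    then show "enat j \<le> height G p x \<longleftrightarrow> enat j \<le> height G p y" for j
      using h[OF p(1)] k(2)[OF p(1), of j] l(2)[OF p(1), of j] by auto
  qed
  have inf: "height G p x = \<infinity> \<longleftrightarrow> height G p y = \<infinity>" if p: "Factorial_Ring.prime p" for p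
  proof -
    have "height G p x = \<infinity> \<longleftrightarrow> (\<forall>j. D p j x)" "height G p y = \<infinity> \<longleftrightarrow> (\<forall>j. D p j y)"
      using h[OF p] enat_eqI_enat_le[of "height G p x" \<infinity>] enat_eqI_enat_le[of "height G p y" \<infinity>] by auto
    then show ?thesis using k(2)[OF p] l(2)[OF p] by blast
  qed
  have "finite {p::nat. p dvd k * l}" using k(1) l(1) by (intro finite_divisors_nat) simp
  then have "finite {p. Factorial_Ring.prime p \<and> height G p x \<noteq> height G p y}"
    using eq by (elim finite_subset[rotated]) blast
  then show "same_type G x y" unfolding same_type_def using inf by metis
qed

text \<open>Equal type leaves finitely many exceptional primes with finite heights, which is the
  input of \<open>equal_characteristics\<close>. The new vector stays on the line of
  \<open>e y\<close>, so it can serve as generator there.\<close>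

lemma same_type_equal_characteristics:
  assumes "same_type G x y" and xy: "x \<in> carrier G" "y \<in> carrier G" "y \<noteq> \<one>"
  shows "\<exists>v\<in>e ` carrier G. v \<noteq> 0 \<and> v \<in> span {e y} \<and>
    (\<forall>m::nat. m > 0 \<longrightarrow> ((1 / of_nat m) *s e x \<in> e ` carrier G \<longleftrightarrow> (1 / of_nat m) *s v \<in> e ` carrier G))"
proof -
  let ?P = "{p. Factorial_Ring.prime p \<and> height G p x \<noteq> height G p y}"
  have P: "finite ?P" "\<And>p. p \<in> ?P \<Longrightarrow> height G p x \<noteq> \<infinity> \<and> height G p y \<noteq> \<infinity>"
    using assms(1) by (auto simp: same_type_def)
  have fin: "\<exists>j. (1 / of_nat (p ^ j)) *s e z \<notin> e ` carrier G"
    if pz: "Factorial_Ring.prime p" "z \<in> carrier G" "height G p z \<noteq> \<infinity>" for p z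
  proof -
    obtain h where "height G p z = enat h" using pz(3) by auto
    then have "\<not> enat (Suc h) \<le> height G p z" by simp
    then show ?thesis using height_ge_iff[OF pz(2)] pz(1) prime_gt_0_nat by blast
  qed
  show ?thesis
  proof (rule equal_characteristics[OF carrier_image imageI[OF xy(1)] P(1) imageI[OF xy(2)]])
    show "e y \<noteq> 0" using xy e_eq_0_iff by simp
    fix p :: nat and j assume "Factorial_Ring.prime p" "p \<notin> ?P"
    then show "(1 / of_nat (p ^ j)) *s e x \<in> e ` carrier G \<longleftrightarrow> (1 / of_nat (p ^ j)) *s e y \<in> e ` carrier G"
      using height_ge_iff[OF xy(1), of p j] height_ge_iff[OF xy(2), of p j] by (auto simp: prime_gt_0_nat)
  next
    fix p assume "p \<in> ?P"
    then show "Factorial_Ring.prime p \<and> (\<exists>j. (1 / of_nat (p ^ j)) *s e x \<notin> e ` carrier G) \<and>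
      (\<exists>j. (1 / of_nat (p ^ j)) *s e y \<notin> e ` carrier G)"
      using P(2)[of p] fin xy by auto
  qed
qed

section \<open>Complete decompositions and a common coefficient group\<close>

lemma fully_decomposableI:
  assumes Z: "finite Z" "\<not> dependent Z" "Z \<subseteq> e ` carrier G"
    and dec: "\<And>r. r \<in> e ` carrier G \<Longrightarrow>
      \<exists>q. r = (\<Sum>z\<in>Z. q z *s z) \<and> (\<forall>z\<in>Z. q z *s z \<in> e ` carrier G)"
  shows "fully_decomposable G"
proof -
  define N where "N z = {g \<in> carrier G. e g \<in> span {z}}" for z
  have sub: "subgroup (N z) G" for z
    unfolding N_def by (intro subgroup_vimage subspace_add_subgroup subspace_span)
  have rank: "rank_one (G\<lparr>carrier := N z\<rparr>)" if z: "z \<in> Z" for z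
  proof -
    interpret N: vector_embedding "G\<lparr>carrier := N z\<rparr>" scale e by (rule vector_embedding_subgroup[OF sub])
    obtain x where x: "x \<in> carrier G" "z = e x" using z Z(3) by blast
    have "z \<noteq> 0" using z Z(2) dependent_zero by blast
    then have "x \<noteq> \<one>" using x e_one by auto
    moreover have "x \<in> N z" using x span_base by (simp add: N_def)
    moreover have "e ` N z \<subseteq> span {e x}" using x by (auto simp: N_def)
    ultimately show ?thesis unfolding N.rank_one_iff by auto
  qed
  have gen: "generate G (\<Union>(N ` Z)) = carrier G"
  proof
    have NG: "\<Union>(N ` Z) \<subseteq> carrier G" by (auto simp: N_def)
    show "generate G (\<Union>(N ` Z)) \<subseteq> carrier G" by (rule generate_incl[OF NG])
    show "carrier G \<subseteq> generate G (\<Union>(N ` Z))"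
    proof
      fix y assume y: "y \<in> carrier G"
      obtain q where q: "e y = (\<Sum>z\<in>Z. q z *s z)" "\<forall>z\<in>Z. q z *s z \<in> e ` carrier G"
        using dec[OF imageI[OF y]] by blast
      have sg: "subgroup (generate G (\<Union>(N ` Z))) G" by (rule generate_is_subgroup[OF NG])
      have "q z *s z \<in> e ` generate G (\<Union>(N ` Z))" if z: "z \<in> Z" for z
      proof -
        obtain g where g: "g \<in> carrier G" "q z *s z = e g" using q(2) z by blast
        have "e g \<in> span {z}" unfolding g(2)[symmetric] by (intro span_scale span_base) simp
        then have "g \<in> N z" using g(1) by (simp add: N_def)
        then have "g \<in> generate G (\<Union>(N ` Z))" using z by (intro generate.incl) blast
        then show ?thesis using g(2) by simp
      qed
      then have "e y \<in> e ` generate G (\<Union>(N ` Z))"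
        unfolding q(1) by (intro add_subgroup_sum[OF add_subgroup_image[OF sg]])
      then show "y \<in> generate G (\<Union>(N ` Z))" using image_mem_iff[OF subgroup.subset[OF sg] y] by simp
    qed
  qed
  have ind: "\<forall>A\<in>F. a A = \<one>" if F: "F \<subseteq> N ` Z" "\<forall>A\<in>F. a A \<in> A" "finprod G a F = \<one>" for F a
  proof -
    \<comment> \<open>The summands are indexed by themselves, so representatives in \<open>Z\<close>
      are chosen to turn the product over subgroups into a sum over independent vectors.\<close>
    obtain Y where Y: "Y \<subseteq> Z" "inj_on N Y" "F = N ` Y" using F(1) by (auto simp: subset_image_inj)
    have aN: "a (N z) \<in> carrier G" "e (a (N z)) \<in> span {z}" if "z \<in> Y" for z
      using F(2) Y(3) that by (auto simp: N_def)
    have "\<forall>z\<in>Y. \<exists>c. e (a (N z)) = c *s z" using aN(2) unfolding span_singleton by auto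
    then obtain c where c: "\<And>z. z \<in> Y \<Longrightarrow> e (a (N z)) = c z *s z" by metis
    have "finprod G a F = finprod G (\<lambda>z. a (N z)) Y"
      unfolding Y(3) using aN(1) by (intro finprod_reindex Y(2)) auto
    then have "e (finprod G (\<lambda>z. a (N z)) Y) = 0" using F(3) e_one by simp
    then have "(\<Sum>z\<in>Y. e (a (N z))) = 0" using e_finprod[of "\<lambda>z. a (N z)" Y] aN(1) by auto
    then have 0: "(\<Sum>z\<in>Y. c z *s z) = 0" using c by simp
    have "finite Y" using Y(1) Z(1) finite_subset by blast
    then have "c z = 0" if "z \<in> Y" for z
      using 0 Z(2) Y(1) that unfolding dependent_explicit by blast
    then have "a (N z) = \<one>" if "z \<in> Y" for z using c[OF that] aN(1)[OF that] e_eq_0_iff that by simp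
    then show ?thesis using Y(3) by blast
  qed
  show ?thesis
    unfolding fully_decomposable_def
    by (rule exI[of _ "N ` Z"]) (use sub rank gen ind in blast)
qed

text \<open>In the line of each summand a vector \<open>x A\<close> is chosen with exactly the
  divisors of one reference element \<open>b A0\<close>. Then \<open>T\<close>, the rationals that
  keep \<open>e (b A0)\<close> in the image, is also the coefficient group of every
  \<open>x A\<close>.\<close>

lemma fully_decomposable_homogeneous_structure:
  assumes fin: "finite_rank G" and fd: "fully_decomposable G" and hom: "homogeneous G"
  shows "\<exists>(I :: 'a set set) T x. finite I \<and> add_subgroup T \<and>
    e ` carrier G = {\<Sum>i\<in>I. t i *s x i | t. \<forall>i\<in>I. t i \<in> T}"
proof -
  let ?M = "e ` carrier G"
  obtain \<A> where "(\<forall>A\<in>\<A>. subgroup A G \<and> rank_one (G\<lparr>carrier := A\<rparr>)) \<and>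
        generate G (\<Union>\<A>) = carrier G \<and>
        (\<forall>F (a :: 'a set \<Rightarrow> 'a). finite F \<longrightarrow> F \<subseteq> \<A> \<longrightarrow> (\<forall>A\<in>F. a A \<in> A) \<longrightarrow>
            finprod G a F = \<one> \<longrightarrow> (\<forall>A\<in>F. a A = \<one>))"
    using fd unfolding fully_decomposable_def by (rule exE)
  then have sub: "\<And>A. A \<in> \<A> \<Longrightarrow> subgroup A G" and rank: "\<And>A. A \<in> \<A> \<Longrightarrow> rank_one (G\<lparr>carrier := A\<rparr>)"
    and gen: "generate G (\<Union>\<A>) = carrier G"
    and ind: "\<And>F a A. finite F \<Longrightarrow> F \<subseteq> \<A> \<Longrightarrow> \<forall>A\<in>F. a A \<in> A \<Longrightarrow> finprod G a F = \<one> \<Longrightarrow> A \<in> F \<Longrightarrow> a A = \<one>"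
    by simp_all
  have "\<exists>b\<in>A. b \<noteq> \<one> \<and> e ` A \<subseteq> span {e b}" if A: "A \<in> \<A>" for A
  proof -
    interpret A: vector_embedding "G\<lparr>carrier := A\<rparr>" scale e by (rule vector_embedding_subgroup[OF sub[OF A]])
    show ?thesis using rank[OF A] unfolding A.rank_one_iff by simp
  qed
  then obtain b where b: "\<And>A. A \<in> \<A> \<Longrightarrow> b A \<in> A" "\<And>A. A \<in> \<A> \<Longrightarrow> b A \<noteq> \<one>"
    "\<And>A. A \<in> \<A> \<Longrightarrow> e ` A \<subseteq> span {e (b A)}" by metis
  have bG: "b A \<in> carrier G" if "A \<in> \<A>" for A using b(1)[OF that] subgroup.subset[OF sub[OF that]] by blast
  have inj: "inj_on b \<A>"
  proof (rule inj_onI, rule ccontr)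
    fix A B assume AB: "A \<in> \<A>" "B \<in> \<A>" "b A = b B" "A \<noteq> B"
    \<comment> \<open>A shared generator would give the forbidden relation of \<open>b A\<close> in
      \<open>A\<close> with its inverse in \<open>B\<close>.\<close>
    let ?a = "\<lambda>C. if C = A then b A else inv (b A)"
    have "finprod G ?a {A, B} = \<one>" using AB bG[OF AB(1)] by simp
    moreover have "\<forall>C\<in>{A, B}. ?a C \<in> C"
      using AB b(1) subgroup.m_inv_closed[OF sub[OF AB(2)]] by (metis insertE singletonD)
    ultimately have "?a A = \<one>" using AB by (intro ind[of "{A, B}" ?a]) auto
    then show False using b(2)[OF AB(1)] by simp
  qed
  have indep: "Defs.independent G (b ` \<A>)"
    unfolding Defs.independent_def
  proof (intro conjI allI impI ballI)
    show "b ` \<A> \<subseteq> carrier G" using bG by blast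
    fix F and c :: "'a \<Rightarrow> int" and s
    assume F: "finite F" "F \<subseteq> b ` \<A>" "(\<Otimes>s\<in>F. s [^] c s) = \<one>" "s \<in> F"
    obtain \<B> where \<B>: "\<B> \<subseteq> \<A>" "finite \<B>" "F = b ` \<B>" using finite_subset_image[OF F(1,2)] by blast
    let ?a = "\<lambda>A. b A [^] c (b A)"
    have "(\<lambda>s. s [^] c s) \<in> b ` \<B> \<rightarrow> carrier G" using bG \<B>(1) by auto
    then have fp: "finprod G ?a \<B> = \<one>"
      using F(3) finprod_reindex[OF _ inj_on_subset[OF inj \<B>(1)]] \<B>(3) by simp
    have mem: "\<forall>A\<in>\<B>. ?a A \<in> A"
    proof
      fix A assume "A \<in> \<B>"
      then have "A \<in> \<A>" using \<B>(1) by blast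
      then show "?a A \<in> A" using subgroup_int_pow_closed[OF sub b(1)] by simp
    qed
    obtain A where A: "A \<in> \<B>" "s = b A" using F(4) \<B>(3) by blast
    have AA: "A \<in> \<A>" using A(1) \<B>(1) by blast
    have "?a A = \<one>" by (rule ind[OF \<B>(2,1) mem fp A(1)])
    then have "of_int (c s) *s e s = 0" using A(2) e_int_pow[OF bG[OF AA], of "c s"] e_one by simp
    moreover have "e s \<noteq> 0" using A(2) b(2)[OF AA] e_eq_0_iff[OF bG[OF AA]] by simp
    ultimately show "c s = 0" by simp
  qed
  obtain B where B: "finite B" "?M \<subseteq> span B" using fin finite_rank_iff by blast
  have "\<not> dependent (e ` b ` \<A>)" using indep independent_iff by simp
  moreover have "e ` b ` \<A> \<subseteq> span B" using bG B(2) by blast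
  ultimately have "finite (e ` b ` \<A>)" using independent_span_bound[OF B(1)] by simp
  moreover have "inj_on e (b ` \<A>)" using bG by (intro inj_on_subset[OF e_inj]) blast
  ultimately have fin\<A>: "finite \<A>" using inj by (metis finite_imageD)
  show ?thesis
  proof (cases "\<A> = {}")
    case True
    then have "carrier G = {\<one>}" using gen generate_empty by simp
    then have "?M = {\<Sum>i\<in>{}. t i *s x i | t. \<forall>i\<in>{}. t i \<in> UNIV}" for x :: "'a set \<Rightarrow> 'b" by (simp add: e_one)
    \<comment> \<open>For the trivial group the empty sum is enough, with an arbitrary choice of
      \<open>T\<close>.\<close>
    then show ?thesis by (intro exI[of _ "{}"] exI[of _ UNIV]) (auto simp: add_subgroup_def)
  next
    case False
    then obtain A0 where A0: "A0 \<in> \<A>" by blast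
    have "\<exists>v\<in>?M. v \<noteq> 0 \<and> v \<in> span {e (b A)} \<and>
      (\<forall>m::nat. m > 0 \<longrightarrow> ((1 / of_nat m) *s e (b A0) \<in> ?M \<longleftrightarrow> (1 / of_nat m) *s v \<in> ?M))" if A: "A \<in> \<A>" for A
      using hom A A0 b(2) bG unfolding homogeneous_def by (intro same_type_equal_characteristics) auto
    then obtain x where x: "\<And>A. A \<in> \<A> \<Longrightarrow> x A \<in> ?M" "\<And>A. A \<in> \<A> \<Longrightarrow> x A \<noteq> 0"
      "\<And>A. A \<in> \<A> \<Longrightarrow> x A \<in> span {e (b A)}"
      "\<And>A m. A \<in> \<A> \<Longrightarrow> m > 0 \<Longrightarrow> (1 / of_nat m) *s e (b A0) \<in> ?M \<longleftrightarrow> (1 / of_nat m) *s x A \<in> ?M"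
      by metis
    define T where "T = {t. t *s e (b A0) \<in> ?M}"
    have T: "add_subgroup T"
      using carrier_image by (auto simp: add_subgroup_def T_def scale_left_diff_distrib)
    \<comment> \<open>Whether \<open>t *s u\<close> lies in the image depends only on the
      denominator of \<open>t\<close> in lowest terms, so equal divisors give equal coefficient
      groups.\<close>
    have lowest: "t *s u \<in> ?M \<longleftrightarrow> (1 / of_nat (nat (snd (quotient_of t)))) *s u \<in> ?M" if u: "u \<in> ?M" for t u
    proof -
      obtain c d where cd: "quotient_of t = (c, d)" by (cases "quotient_of t")
      then have d: "d > 0" "t = of_int c / of_int d" "coprime c d"
        by (simp_all add: quotient_of_denom_pos quotient_of_div quotient_of_coprime)
      have t: "t = of_int c / of_nat (nat d)" using d by simp
      show ?thesis
      proof
        assume "t *s u \<in> ?M"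
        then have "(1 / of_nat (nat d)) *s u \<in> ?M"
          using d t u by (intro divide_coprime_cancel[OF carrier_image u, of c]) auto
        then show "(1 / of_nat (nat (snd (quotient_of t)))) *s u \<in> ?M" by (simp add: cd)
      next
        assume "(1 / of_nat (nat (snd (quotient_of t)))) *s u \<in> ?M"
        then have "of_int c *s (1 / of_nat (nat d)) *s u \<in> ?M"
          by (intro add_subgroup_scale_int[OF carrier_image]) (simp add: cd)
        then show "t *s u \<in> ?M" unfolding t by simp
      qed
    qed
    have T_iff: "t \<in> T \<longleftrightarrow> t *s x A \<in> ?M" if A: "A \<in> \<A>" for t A
    proof -
      have "nat (snd (quotient_of t)) > 0" using quotient_of_denom_pos'[of t] by simp
      then show ?thesis unfolding T_def mem_Collect_eq
        using lowest[OF imageI[OF bG[OF A0]], of t] lowest[OF x(1)[OF A], of t] x(4)[OF A] by blast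
    qed
    define W where "W = {\<Sum>i\<in>\<A>. t i *s x i | t. \<forall>i\<in>\<A>. t i \<in> T}"
    have W: "add_subgroup W" unfolding W_def by (rule add_subgroup_combinations[OF T])
    have AW: "e a \<in> W" if A: "A \<in> \<A>" "a \<in> A" for a A
    proof -
      have aG: "a \<in> carrier G" using A subgroup.subset[OF sub[OF A(1)]] by blast
      obtain k where k: "x A = k *s e (b A)" using x(3)[OF A(1)] unfolding span_singleton by auto
      obtain l where l: "e a = l *s e (b A)" using b(3)[OF A(1)] A(2) unfolding span_singleton by auto
      have "k \<noteq> 0" using k x(2)[OF A(1)] by auto
      then have ea: "e a = (l / k) *s x A" using k l by simp
      then have "l / k \<in> T" using T_iff[OF A(1)] aG by (metis imageI)
      moreover have "e a = (\<Sum>i\<in>\<A>. (if i = A then l / k else 0) *s x i)"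
        using fin\<A> A(1) ea by (subst sum.remove[of _ A]) auto
      ultimately show ?thesis unfolding W_def using add_subgroup_zero[OF T]
        by (intro CollectI exI[of _ "\<lambda>i. if i = A then l / k else 0"]) auto
    qed
    have "generate G (\<Union>\<A>) \<subseteq> {g \<in> carrier G. e g \<in> W}"
      using AW subgroup.subset[OF sub] by (intro generate_subgroup_incl subgroup_vimage[OF W]) blast
    then have "?M \<subseteq> W" using gen by blast
    moreover have "W \<subseteq> ?M" unfolding W_def using T_iff by (auto intro!: add_subgroup_sum[OF carrier_image])
    ultimately have "?M = W" by blast
    then show ?thesis unfolding W_def using fin\<A> T by blast
  qed
qed

section \<open>The structure theorem for embedded groups, in both directions\<close>

lemma semi_generalized_Bassian_split:
  assumes "semi_generalized_Bassian G" "\<not> finite_rank G"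
  shows "\<exists>D R. subgroup D G \<and> subgroup R G \<and> D \<inter> R = {\<one>} \<and> D <#> R = carrier G \<and>
       divisible (G\<lparr>carrier := D\<rparr>) \<and> \<not> finite_rank (G\<lparr>carrier := D\<rparr>) \<and>
       finite_rank (G\<lparr>carrier := R\<rparr>) \<and> fully_decomposable (G\<lparr>carrier := R\<rparr>) \<and>
       homogeneous (G\<lparr>carrier := R\<rparr>)"
proof -
  let ?M = "e ` carrier G"
  have "pure_Bassian ?M" using assms(1) semi_generalized_Bassian_iff by simp
  moreover have "\<not> (\<exists>B. finite B \<and> ?M \<subseteq> span B)" using assms(2) finite_rank_iff by simp
  ultimately obtain D R Z where DR: "direct_sum ?M D R" "subspace D" "\<not> (\<exists>B. finite B \<and> D \<subseteq> span B)"
    and Z: "finite Z" "independent Z" "Z \<subseteq> R"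
      "\<forall>r\<in>R. \<exists>q. r = (\<Sum>z\<in>Z. q z *s z) \<and> (\<forall>z\<in>Z. q z *s z \<in> R)"
    and hom: "\<forall>y\<in>R. \<forall>z\<in>R. y \<noteq> 0 \<longrightarrow> (\<exists>k::nat. k > 0 \<and>
      (\<forall>m::nat. m > 0 \<longrightarrow> (1 / of_nat m) *s y \<in> R \<longrightarrow> (of_nat k / of_nat m) *s z \<in> R))"
    by (elim pure_Bassian_structure[OF carrier_image, elim_format] exE conjE)
  define D' R' where "D' = {x \<in> carrier G. e x \<in> D}" and "R' = {x \<in> carrier G. e x \<in> R}"
  have sub: "subgroup D' G" "subgroup R' G"
    unfolding D'_def R'_def by (intro subgroup_vimage direct_sum_subgroups[OF DR(1)])+
  have im: "e ` D' = D" "e ` R' = R"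
    unfolding D'_def R'_def using direct_sum_left[OF DR(1)] direct_sum_right[OF DR(1)]
    by (auto intro!: image_vimage)
  interpret D: vector_embedding "G\<lparr>carrier := D'\<rparr>" scale e by (rule vector_embedding_subgroup[OF sub(1)])
  interpret R: vector_embedding "G\<lparr>carrier := R'\<rparr>" scale e by (rule vector_embedding_subgroup[OF sub(2)])
  have "D' \<inter> R' = {\<one>} \<and> D' <#> R' = carrier G" using direct_sum_iff[OF sub] im DR(1) by simp
  moreover have "divisible (G\<lparr>carrier := D'\<rparr>)" using D.divisible_iff im DR(2) by simp
  moreover have "\<not> finite_rank (G\<lparr>carrier := D'\<rparr>)" using D.finite_rank_iff im DR(3) by simp
  moreover have "finite_rank (G\<lparr>carrier := R'\<rparr>)"
  proof -
    have "r \<in> span Z" if r: "r \<in> R" for r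
    proof -
      obtain q where "r = (\<Sum>z\<in>Z. q z *s z)" using Z(4) r by blast
      then show ?thesis by (simp add: span_sum span_scale span_base)
    qed
    then have "finite Z \<and> e ` carrier (G\<lparr>carrier := R'\<rparr>) \<subseteq> span Z" using Z(1) im by auto
    then show ?thesis using R.finite_rank_iff by blast
  qed
  moreover have "fully_decomposable (G\<lparr>carrier := R'\<rparr>)"
    using Z(3,4) im by (intro R.fully_decomposableI[OF Z(1,2)]) simp_all
  moreover have "homogeneous (G\<lparr>carrier := R'\<rparr>)"
    using hom im by (intro R.homogeneousI) simp
  ultimately show ?thesis using sub by blast
qed

lemma split_semi_generalized_Bassian:
  assumes sub: "subgroup D G" "subgroup R G" and DR: "D \<inter> R = {\<one>}" "D <#> R = carrier G"
    and div: "divisible (G\<lparr>carrier := D\<rparr>)"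
    and R: "finite_rank (G\<lparr>carrier := R\<rparr>)" "fully_decomposable (G\<lparr>carrier := R\<rparr>)"
      "homogeneous (G\<lparr>carrier := R\<rparr>)"
  shows "semi_generalized_Bassian G"
proof -
  let ?M = "e ` carrier G"
  interpret D: vector_embedding "G\<lparr>carrier := D\<rparr>" scale e by (rule vector_embedding_subgroup[OF sub(1)])
  interpret R: vector_embedding "G\<lparr>carrier := R\<rparr>" scale e by (rule vector_embedding_subgroup[OF sub(2)])
  have ds: "direct_sum ?M (e ` D) (e ` R)" using direct_sum_iff[OF sub] DR by simp
  have D: "subspace (e ` D)" using D.divisible_iff div by simp
  obtain I :: "'a set set" and T x where I: "finite I" "add_subgroup T"
    "e ` R = {\<Sum>i\<in>I. t i *s x i | t. \<forall>i\<in>I. t i \<in> T}"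
    using R.fully_decomposable_homogeneous_structure[OF R] by (elim exE conjE) simp
  have "\<exists>C. direct_sum ?M (?M \<inter> span H) C" for H
    by (rule pure_splits_divisible_plus_homogeneous[OF ds D subspace_span I(2,1,3)])
  then have "pure_Bassian ?M" unfolding pure_Bassian_def by simp
  then show ?thesis using semi_generalized_Bassian_iff by simp
qed

lemma finite_rank_semi_generalized_Bassian: "finite_rank G \<Longrightarrow> semi_generalized_Bassian G"
  using finite_rank_iff pure_Bassian_finite_dim[OF carrier_image] semi_generalized_Bassian_iff by auto

end

theorem theorem2p8:
  fixes G :: "('a, 'b) monoid_scheme"
  assumes "comm_group G" and "torsion_free G"
  shows "semi_generalized_Bassian G \<longleftrightarrow>
    finite_rank G \<or>
    (\<exists>D R. subgroup D G \<and> subgroup R G \<and> D \<inter> R = {\<one>\<^bsub>G\<^esub>} \<and> D <#>\<^bsub>G\<^esub> R = carrier G \<and>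
       divisible (G\<lparr>carrier := D\<rparr>) \<and> \<not> finite_rank (G\<lparr>carrier := D\<rparr>) \<and>
       finite_rank (G\<lparr>carrier := R\<rparr>) \<and> fully_decomposable (G\<lparr>carrier := R\<rparr>) \<and>
       homogeneous (G\<lparr>carrier := R\<rparr>))"
proof -
  interpret G: comm_group G by fact
  obtain e :: "'a \<Rightarrow> 'a \<Rightarrow> rat"
    where e: "\<forall>x\<in>carrier G. \<forall>y\<in>carrier G. \<forall>s. e (x \<otimes>\<^bsub>G\<^esub> y) s = e x s + e y s" "inj_on e (carrier G)"
    using G.torsion_free_embedding[OF assms(2)] by blast
  \<comment> \<open>The ambient space consists of all functions to the rationals with pointwise
    operations; the coordinates of elements of \<open>G\<close> are points in it.\<close>
  define scale :: "rat \<Rightarrow> ('a \<Rightarrow> rat) \<Rightarrow> 'a \<Rightarrow> rat" where "scale q f = (\<lambda>s. q * f s)" for q f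
  interpret vector_embedding G scale e
    by unfold_locales (use e in \<open>auto simp: scale_def plus_fun_def algebra_simps\<close>)
  show ?thesis
    using semi_generalized_Bassian_split split_semi_generalized_Bassian finite_rank_semi_generalized_Bassian
    by metis
qed

end
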